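(* Let $\lambda=(\lambda_1,\ldots,\lambda_n)$ be a partition and $m=\lambda_1$. The RSK correspondence, when restricted to the set $\mathcal{B}_\lambda$ of lexicographically ordered $\lambda$-admissible biwords, provides a bijection $$\operatorname{RSK}\colon \mathcal{B}_\lambda\longrightarrow \mathcal{G}_\lambda=\bigcup_{\alpha\in\operatorname{Comp}(\lambda)}\bigl(\mathcal{S}^\lambda(\alpha)\times\mathcal{S}(\alpha)\bigr).$$
   Context: $\mathbb N=\{0,1,2,\ldots\}$, $[n]=\{1,\ldots,n\}$. $\operatorname{Tab}_{[r]}$ is the set of semistandard Young tableaux (English notation; rows weakly increasing left to right, columns strictly increasing top to bottom) with entries in $[r]$, and $\operatorname{Tab}_{[r]}(\nu)$ those of shape $\nu$. For fillings of the same shape, $\leq$ means entrywise comparison. For a weak composition $\alpha\in\mathbb N^n$, $\alpha^+$ is its weakly decreasing rearrangement and $K(\alpha)$ is the key tableau of shape $\alpha^+$ and content $\alpha$ (column $r$ consists of $\{i:\alpha_i\ge r\}$). $K_+(T)$ is the (Lascoux–Schützenberger) right key of $T$, a key tableau of the same shape. Equivalently: let $T_r$ be the subtableau of the columns of $T$ weakly to the right of column $r$, with reading word obtained by reading rows left to right, from the bottom row to the top row; then column $r$ of $K_+(T)$, read from bottom to top, is $\sup W(T_r)$, where $W(T_r)$ is the set of strictly decreasing subwords of the reading word, and for a nonempty set $A$ of decreasing words of maximal length $t$, $\sup A=w_1\cdots w_t$ with $w_i$ the maximum of the $i$-th letters of the words of $A$ of length at least $i$. Partitions may be padded with trailing zeros;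 write $\lambda[i]=\lambda_i$. $B_+^\lambda(\alpha)$ is the filling of shape $\alpha^+$ such that, if column $r$ has length $c_r$, its $i$-th entry from the top is $\lambda[\,\cdot\,]$ applied to the $(c_r+1-i)$-th entry from the top of column $r$ of $K(\alpha)$. For a weakly increasing integer column written from bottom to top as $c_1\ge\cdots\ge c_k$, its strictification $\operatorname{str}(c)$ is the column $d_1>\cdots>d_k$ (bottom to top) with $d_1=c_1$, $d_i=\min\{d_{i-1}-1,c_i\}$. If the columnwise strictification $\operatorname{str}(B_+^\lambda(\alpha))$ has only positive entries (vacuously true if $\alpha=0$), it is a key tableau and $\alpha^\lambda\in\mathbb N^m$ is the unique weak composition with $K(\alpha^\lambda)=\operatorname{str}(B_+^\lambda(\alpha))$; otherwise $\alpha^\lambda$ does not exist. $\operatorname{Comp}(\lambda)=\{\alpha\in\mathbb N^n:\alpha^\lambda\text{ exists}\}$. $\mathcal S(\alpha)=\{Q\in\operatorname{Tab}_{[n]}(\alpha^+):K_+(Q)=K(\alpha)\}$ and $\mathcal S^\lambda(\alpha)=\{P\in\operatorname{Tab}_{[m]}(\alpha^+):K_+(P)\le B_+^\lambda(\alpha)\}$. A biletter $\binom ij$ (with $i\in[n]$, $j\in[m]$) is $\lambda$-admissible if $j\le\lambda[i]$. A biword is $\lambda$-admissible if all its biletters are; it is lexicographically ordered if $i_1\le i_2\le\cdots\le i_r$ and $j_k\le j_{k+1}$ whenever $i_k=i_{k+1}$. The RSK correspondence sends such a biword to $(P,Q)$, where $P$ is obtained by successively row-inserting $j_1,\ldots,j_r$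 and $Q$ is the recording tableau, with $i_k$ placed in the cell added at step $k$. *)

theory Defs
  imports Main
begin

text \<open>
  A filling is the list of its rows from top to bottom (English notation), empty rows being
  omitted; \<^const>\<open>transpose\<close> then yields the list of its columns, each read from top to bottom.
  A weak composition in \<open>\<nat>\<^sup>n\<close> is a list of length \<open>n\<close>. The letters of \<open>[n]\<close> start at 1,
  whereas list positions (and the row and column indices below) start at 0.
\<close>

type_synonym 'a filling = "'a list list"

text \<open>The part \<open>\<lambda>[i]\<close>, with \<open>i\<close> counted from 1; partitions are padded with zeros.\<close>

definition part :: "nat list \<Rightarrow> nat \<Rightarrow> nat" where
  "part lam i = (if 1 \<le> i \<and> i \<le> length lam then lam ! (i - 1) else 0)"

definition ssyt :: "nat filling \<Rightarrow> bool" where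
  "ssyt T \<longleftrightarrow>
     [] \<notin> set T \<and> sorted_wrt (\<ge>) (map length T) \<and>
     (\<forall>row \<in> set T. sorted_wrt (\<le>) row) \<and>
     (\<forall>col \<in> set (transpose T). sorted_wrt (<) col)"

text \<open>Trailing zeros of \<open>\<nu>\<close> correspond to no row of the tableau.\<close>

definition Tab :: "nat \<Rightarrow> nat list \<Rightarrow> nat filling set" where
  "Tab r \<nu> = {T. ssyt T \<and> \<Union> (set (map set T)) \<subseteq> {1..r} \<and>
                 map length T = filter (\<lambda>k. k \<noteq> 0) \<nu>}"

definition filling_le :: "nat filling \<Rightarrow> nat filling \<Rightarrow> bool" where
  "filling_le S T \<longleftrightarrow> list_all2 (list_all2 (\<le>)) S T"

definition decr_rearr :: "nat list \<Rightarrow> nat list" where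
  "decr_rearr \<alpha> = rev (sort \<alpha>)"

definition key :: "nat list \<Rightarrow> nat filling" where
  "key \<alpha> = transpose
     (map (\<lambda>r. sorted_list_of_set {i \<in> {1..length \<alpha>}. part \<alpha> i \<ge> r})
        [1..<Suc (Max (insert 0 (set \<alpha>)))])"

definition reading_word :: "nat filling \<Rightarrow> nat list" where
  "reading_word T = concat (rev T)"

definition decr_subwords :: "nat filling \<Rightarrow> nat list set" where
  "decr_subwords T = {u \<in> set (subseqs (reading_word T)). sorted_wrt (>) u}"

definition sup_words :: "nat list set \<Rightarrow> nat list" where
  "sup_words A = map (\<lambda>i. Max ((\<lambda>u. u ! i) ` {u \<in> A. i < length u}))
                   [0..<Max (length ` A)]"

text \<open>
  The Lascoux--Schuetzenberger right key. The subtableau formed by the columns weakly to the right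
  of column \<open>r\<close> is \<open>map (drop r) T\<close>; rows that become empty do not affect its reading word.
  The word \<open>sup_words\<close> lists the key column from bottom to top, hence the reversal.
\<close>

definition right_key :: "nat filling \<Rightarrow> nat filling" where
  "right_key T = transpose
     (map (\<lambda>r. rev (sup_words (decr_subwords (map (drop r) T)))) [0..<length (transpose T)])"

definition B_plus :: "nat list \<Rightarrow> nat list \<Rightarrow> nat filling" where
  "B_plus lam \<alpha> = transpose (map (\<lambda>col. map (part lam) (rev col)) (transpose (key \<alpha>)))"

text \<open>
  Strictification of a column read from bottom to top. The first letter of the argument of the
  recursive call is \<open>d\<^sub>2\<close>. Entries are integers, as they may become negative.
\<close>

fun strictify :: "int list \<Rightarrow> int list" where
  "strictify [] = []"
| "strictify [c] = [c]"
| "strictify (c # c' # cs) = c # strictify (min (c - 1) c' # cs)"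

definition str_B_plus :: "nat list \<Rightarrow> nat list \<Rightarrow> int filling" where
  "str_B_plus lam \<alpha> =
     transpose (map (\<lambda>col. rev (strictify (rev (map int col)))) (transpose (B_plus lam \<alpha>)))"

text \<open>The weak composition \<open>\<alpha>\<^sup>\<lambda>\<close>, with \<^const>\<open>None\<close> if it does not exist.\<close>

definition comp_pow :: "nat list \<Rightarrow> nat list \<Rightarrow> nat list option" where
  "comp_pow lam \<alpha> =
     (if \<forall>row \<in> set (str_B_plus lam \<alpha>). \<forall>x \<in> set row. x > 0
      then Some (THE \<beta>. length \<beta> = part lam 1 \<and>
                         map (map int) (key \<beta>) = str_B_plus lam \<alpha>)
      else None)"

definition Comp :: "nat list \<Rightarrow> nat list set" where
  "Comp lam = {\<alpha>. length \<alpha> = length lam \<and> comp_pow lam \<alpha> \<noteq> None}"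

definition S_right :: "nat list \<Rightarrow> nat filling set" where
  "S_right \<alpha> = {Q \<in> Tab (length \<alpha>) (decr_rearr \<alpha>). right_key Q = key \<alpha>}"

definition S_left :: "nat list \<Rightarrow> nat list \<Rightarrow> nat filling set" where
  "S_left lam \<alpha> =
     {P \<in> Tab (part lam 1) (decr_rearr \<alpha>). filling_le (right_key P) (B_plus lam \<alpha>)}"

definition G :: "nat list \<Rightarrow> (nat filling \<times> nat filling) set" where
  "G lam = (\<Union>\<alpha> \<in> Comp lam. S_left lam \<alpha> \<times> S_right \<alpha>)"

text \<open>A biword is the list of its biletters, written as pairs \<open>(i, j)\<close> with \<open>i\<close> on top.\<close>

definition admissible :: "nat list \<Rightarrow> nat \<times> nat \<Rightarrow> bool" where
  "admissible lam b \<longleftrightarrow>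
     fst b \<in> {1..length lam} \<and> snd b \<in> {1..part lam 1} \<and> snd b \<le> part lam (fst b)"

definition lex_ordered :: "(nat \<times> nat) list \<Rightarrow> bool" where
  "lex_ordered w \<longleftrightarrow>
     (\<forall>k. Suc k < length w \<longrightarrow>
        fst (w ! k) \<le> fst (w ! Suc k) \<and>
        (fst (w ! k) = fst (w ! Suc k) \<longrightarrow> snd (w ! k) \<le> snd (w ! Suc k)))"

definition admissible_biwords :: "nat list \<Rightarrow> (nat \<times> nat) list set" where
  "admissible_biwords lam = {w. lex_ordered w \<and> (\<forall>b \<in> set w. admissible lam b)}"

text \<open>
  Insertion of \<open>x\<close> into a row replaces the leftmost entry greater than \<open>x\<close>, which is returned,
  or appends \<open>x\<close> if there is none.
\<close>

fun bump :: "nat \<Rightarrow> nat list \<Rightarrow> nat list \<times> nat option" where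
  "bump x [] = ([x], None)"
| "bump x (y # ys) =
     (if x < y then (x # ys, Some y) else (let (ys', z) = bump x ys in (y # ys', z)))"

text \<open>Row insertion, returning also the index of the row in which the new cell appears.\<close>

fun row_insert :: "nat \<Rightarrow> nat filling \<Rightarrow> nat filling \<times> nat" where
  "row_insert x [] = ([[x]], 0)"
| "row_insert x (row # T) =
     (case bump x row of
        (row', None) \<Rightarrow> (row' # T, 0)
      | (row', Some y) \<Rightarrow> (let (T', k) = row_insert y T in (row' # T', Suc k)))"

definition add_cell :: "nat \<Rightarrow> nat \<Rightarrow> nat filling \<Rightarrow> nat filling" where
  "add_cell i k Q = (if k < length Q then Q[k := Q ! k @ [i]] else Q @ [[i]])"

definition rsk_step ::
  "nat filling \<times> nat filling \<Rightarrow> nat \<times> nat \<Rightarrow> nat filling \<times> nat filling" where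
  "rsk_step PQ b =
     (let (P', k) = row_insert (snd b) (fst PQ) in (P', add_cell (fst b) k (snd PQ)))"

definition RSK :: "(nat \<times> nat) list \<Rightarrow> nat filling \<times> nat filling" where
  "RSK w = foldl rsk_step ([], []) w"

end

theory Submission
  imports Defs "HOL-Library.Sublist" "HOL-Library.Multiset"
begin

text \<open>
  Write \<open>T\<^sub>r\<close> for the columns of \<open>T\<close> weakly to the right of column \<open>r\<close>, \<open>D(T, b, r)\<close> for the length of
  a longest decreasing subword with letters above \<open>b\<close> of the reading word of \<open>T\<^sub>r\<close>, and \<open>c\<^sub>r\<close> for the
  length of column \<open>r\<close>. Column \<open>r\<close> of \<open>K\<^sub>+(T)\<close> has exactly \<open>D(T, b, r)\<close> entries above \<open>b\<close>, so
  \<open>K\<^sub>+(P) \<le> B\<^sub>+(\<alpha>)\<close> with \<open>K(\<alpha>) = K\<^sub>+(Q)\<close> means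
  \<open>D(P, \<lambda>[a], r) + D(Q, a - 1, r) \<le> c\<^sub>r\<close> for all \<open>a\<close> and \<open>r\<close>. As \<open>\<lambda>\<close> is weakly decreasing, a biword is
  admissible iff for no \<open>a\<close> it has a biletter \<open>(i, j)\<close> with \<open>i \<ge> a\<close> and \<open>j > \<lambda>[a]\<close>. Hence it suffices
  that for arbitrary thresholds \<open>a, b\<close> there is no biletter with \<open>i > a\<close> and \<open>j > b\<close> iff
  \<open>D(P, b, r) + D(Q, a, r) \<le> c\<^sub>r\<close> for all \<open>r\<close>.

  This follows by induction on the biword. Suppose that its last biletter \<open>(i, j)\<close>, where \<open>i > a\<close>,
  creates a cell in column \<open>s\<close>. Then \<open>D(Q, a, r)\<close> grows by one for exactly those \<open>r \<le> s\<close> with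
  \<open>D(Q, a, r) = D(Q, a, s)\<close>. If \<open>j > b\<close>, the bumped letters give a decreasing word that violates the
  inequality for \<open>r = s\<close>. If \<open>j \<le> b\<close>, then \<open>D(P, b, r)\<close> does not change for \<open>r \<le> s\<close>, and for \<open>r > s\<close>
  it can only drop if \<open>c\<^sub>r - D(P, b, r) \<ge> c\<^sub>s - D(P, b, s)\<close>; together with the monotonicity of
  \<open>c\<^sub>r - D(P, b, r)\<close> in \<open>r\<close> the inequalities before and after the insertion are equivalent.

  That \<open>K\<^sub>+(Q)\<close> is the key of some \<open>\<alpha>\<close> amounts to its columns being nested, and \<open>\<alpha>\<^sup>\<lambda>\<close> exists because the
  strictification of \<open>B\<^sub>+(\<alpha>)\<close> still dominates the strictly increasing columns of \<open>K\<^sub>+(P)\<close>.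
\<close>


subsection \<open>Tableaux by rows\<close>

text \<open>Combines the partition shape and the strictness of columns in one transitive relation on
  rows, so that tableaux can be handled row by row without \<open>transpose\<close>.\<close>

definition above :: "nat list \<Rightarrow> nat list \<Rightarrow> bool" where
  "above R S \<longleftrightarrow> length S \<le> length R \<and> (\<forall>j < length S. R ! j < S ! j)"

lemma transp_above: "transp above"
  unfolding transp_def above_def by (meson dual_order.trans order_less_le_trans order_less_trans)

lemma sorted_wrt_filter_iff:
  "sorted_wrt P (filter Q xs) \<longleftrightarrow> sorted_wrt (\<lambda>x y. Q x \<longrightarrow> Q y \<longrightarrow> P x y) xs"
  by (induction xs) auto

lemma length_transpose_gt_iff: "j < length (transpose xs) \<longleftrightarrow> (\<exists>row \<in> set xs. j < length row)"
  unfolding length_transpose by (induction xs) (auto simp: less_max_iff_disj)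

text \<open>Past the last column the lists are empty and hence sorted, which lets \<open>j\<close>
  range over all numbers.\<close>

lemma ball_transpose:
  "(\<forall>col \<in> set (transpose T). sorted_wrt P col) \<longleftrightarrow>
   (\<forall>j. sorted_wrt P (map (\<lambda>row. row ! j) (filter (\<lambda>row. j < length row) T)))"
proof
  assume L: "\<forall>col \<in> set (transpose T). sorted_wrt P col"
  show "\<forall>j. sorted_wrt P (map (\<lambda>row. row ! j) (filter (\<lambda>row. j < length row) T))"
  proof
    fix j
    show "sorted_wrt P (map (\<lambda>row. row ! j) (filter (\<lambda>row. j < length row) T))"
    proof (cases "j < length (transpose T)")
      case True
      have "sorted_wrt P (transpose T ! j)" using L nth_mem[OF True] by (rule bspec)
      then show ?thesis by (simp add: nth_transpose[OF True])
    next
      case False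
      then have "filter (\<lambda>row. j < length row) T = []"
        by (auto simp: length_transpose_gt_iff filter_empty_conv)
      then show ?thesis by simp
    qed
  qed
next
  assume "\<forall>j. sorted_wrt P (map (\<lambda>row. row ! j) (filter (\<lambda>row. j < length row) T))"
  then show "\<forall>col \<in> set (transpose T). sorted_wrt P col"
    by (fastforce simp: in_set_conv_nth nth_transpose)
qed

lemma ssyt_iff:
  "ssyt T \<longleftrightarrow> [] \<notin> set T \<and> (\<forall>row \<in> set T. sorted row) \<and> sorted_wrt above T"
proof -
  have "sorted_wrt (\<ge>) (map length T) \<and> (\<forall>col \<in> set (transpose T). sorted_wrt (<) col) \<longleftrightarrow>
      sorted_wrt (\<lambda>R S. length S \<le> length R) T \<and> (\<forall>j. sorted_wrt (\<lambda>R S.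
        j < length R \<longrightarrow> j < length S \<longrightarrow> R ! j < S ! j) T)"
    by (simp only: ball_transpose sorted_wrt_map sorted_wrt_filter_iff)
  also have "\<dots> \<longleftrightarrow> sorted_wrt above T"
    by (induction T) (auto simp: above_def)
  finally show ?thesis unfolding ssyt_def by blast
qed

lemma ssyt_Nil [simp]: "ssyt []"
  by (simp add: ssyt_iff)

lemma ssyt_Cons:
  "ssyt (R # T) \<longleftrightarrow> R \<noteq> [] \<and> sorted R \<and> ssyt T \<and> (\<forall>S \<in> set T. above R S)"
  by (auto simp: ssyt_iff)

lemma ssyt_Cons_Cons: "ssyt (R # S # T) \<longleftrightarrow> R \<noteq> [] \<and> sorted R \<and> ssyt (S # T) \<and> above R S"
  unfolding ssyt_iff sorted_wrt2[OF transp_above] by auto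

subsection \<open>Longest decreasing subwords above a threshold\<close>

definition decr_sub :: "nat \<Rightarrow> nat list \<Rightarrow> nat list \<Rightarrow> bool" where
  "decr_sub b w u \<longleftrightarrow> subseq u w \<and> sorted_wrt (>) u \<and> (\<forall>x \<in> set u. b < x)"

definition longest_decr :: "nat \<Rightarrow> nat list \<Rightarrow> nat" where
  "longest_decr b w = Max (length ` {u. decr_sub b w u})"

lemma finite_decr_sub: "finite {u. decr_sub b w u}"
  by (rule finite_subset[of _ "set (subseqs w)"]) (auto simp: decr_sub_def)

lemma decr_sub_Nil [simp]: "decr_sub b w []"
  by (simp add: decr_sub_def)

lemma decr_sub_length_le: "decr_sub b w u \<Longrightarrow> length u \<le> longest_decr b w"
  unfolding longest_decr_def by (intro Max_ge) (auto simp: finite_decr_sub)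

lemma longest_decr_attained: obtains u where "decr_sub b w u" "length u = longest_decr b w"
proof -
  have "longest_decr b w \<in> length ` {u. decr_sub b w u}"
    unfolding longest_decr_def
    by (intro Max_in) (use finite_decr_sub decr_sub_Nil in blast)+
  then show ?thesis using that by auto
qed

lemma longest_decr_leI:
  assumes "\<And>u. decr_sub b w u \<Longrightarrow> length u \<le> n" shows "longest_decr b w \<le> n"
  using assms longest_decr_attained by metis

lemma decr_sub_subseq: "decr_sub b w u \<Longrightarrow> subseq w w' \<Longrightarrow> decr_sub b w' u"
  unfolding decr_sub_def using subseq_order.order_trans by blast

lemma longest_decr_mono: "subseq w w' \<Longrightarrow> longest_decr b w \<le> longest_decr b w'"
  using decr_sub_subseq decr_sub_length_le longest_decr_leI by metis

lemma decr_sub_append_iff: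
  "decr_sub b (v @ w) u \<longleftrightarrow> (\<exists>u1 u2. u = u1 @ u2 \<and> decr_sub b v u1 \<and> decr_sub b w u2 \<and>
     (\<forall>x \<in> set u1. \<forall>y \<in> set u2. x > y))"
proof
  assume "decr_sub b (v @ w) u"
  then obtain u1 u2 where *: "u = u1 @ u2" "subseq u1 v" "subseq u2 w" "sorted_wrt (>) u"
      "\<forall>x \<in> set u. b < x"
    unfolding decr_sub_def subseq_append_iff by blast
  then show "\<exists>u1 u2. u = u1 @ u2 \<and> decr_sub b v u1 \<and> decr_sub b w u2 \<and>
      (\<forall>x \<in> set u1. \<forall>y \<in> set u2. x > y)"
    by (intro exI[of _ u1] exI[of _ u2]) (simp add: decr_sub_def sorted_wrt_append)
next
  assume "\<exists>u1 u2. u = u1 @ u2 \<and> decr_sub b v u1 \<and> decr_sub b w u2 \<and>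
      (\<forall>x \<in> set u1. \<forall>y \<in> set u2. x > y)"
  then obtain u1 u2 where *: "u = u1 @ u2" "decr_sub b v u1" "decr_sub b w u2"
      "\<forall>x \<in> set u1. \<forall>y \<in> set u2. x > y" by blast
  then show "decr_sub b (v @ w) u"
    by (auto simp: decr_sub_def sorted_wrt_append list_emb_append_mono)
qed

lemma longest_decr_antimono: "b \<le> b' \<Longrightarrow> longest_decr b' w \<le> longest_decr b w"
  by (rule longest_decr_leI, rule decr_sub_length_le) (fastforce simp: decr_sub_def)

lemma decr_sub_set: "decr_sub b w u \<Longrightarrow> x \<in> set u \<Longrightarrow> x \<in> set w \<and> b < x"
  unfolding decr_sub_def by (auto elim: list_emb_set)

lemma longest_decr_eq_0: "(\<And>x. x \<in> set w \<Longrightarrow> x \<le> b) \<Longrightarrow> longest_decr b w = 0"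
proof -
  assume *: "\<And>x. x \<in> set w \<Longrightarrow> x \<le> b"
  have "longest_decr b w \<le> 0"
  proof (rule longest_decr_leI)
    fix u assume "decr_sub b w u"
    then have "u = []" using * decr_sub_set by (cases u) fastforce+
    then show "length u \<le> 0" by simp
  qed
  then show ?thesis by simp
qed

text \<open>A subword uses this occurrence of \<open>x\<close> at most once, and omitting it leaves
  a subword of \<open>w @ v\<close>.\<close>

lemma longest_decr_Cons_le: "longest_decr b (w @ x # v) \<le> Suc (longest_decr b (w @ v))"
proof (rule longest_decr_leI)
  fix u assume u: "decr_sub b (w @ x # v) u"
  then obtain u1 u2 where *: "u = u1 @ u2" "subseq u1 w" "subseq u2 (x # v)"
    unfolding decr_sub_def subseq_append_iff by blast
  show "length u \<le> Suc (longest_decr b (w @ v))"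
  proof (cases u2)
    case Nil
    then have "decr_sub b (w @ v) u"
      using u * by (auto simp: decr_sub_def)
    then show ?thesis using decr_sub_length_le le_SucI by blast
  next
    case (Cons y u3)
    then have "subseq u3 v" using *(3) by (cases "y = x") (auto dest: subseq_Cons')
    moreover from this have "subseq (u1 @ u3) (w @ v)" using * by (simp add: list_emb_append_mono)
    ultimately have "decr_sub b (w @ v) (u1 @ u3)"
      using u * Cons by (auto simp: decr_sub_def sorted_wrt_append)
    then show ?thesis using decr_sub_length_le[of b "w @ v" "u1 @ u3"] * Cons by simp
  qed
qed

lemma longest_decr_Cons_max:
  assumes "b < x" "\<And>y. y \<in> set w \<Longrightarrow> y < x"
  shows "longest_decr b (x # w) = Suc (longest_decr b w)"
proof (rule antisym)
  show "longest_decr b (x # w) \<le> Suc (longest_decr b w)"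
    using longest_decr_Cons_le[of b "[]"] by simp
  obtain u where u: "decr_sub b w u" "length u = longest_decr b w"
    by (rule longest_decr_attained)
  then have "decr_sub b (x # w) (x # u)"
    using assms unfolding decr_sub_def by (auto elim: list_emb_set)
  then show "Suc (longest_decr b w) \<le> longest_decr b (x # w)"
    using decr_sub_length_le u by fastforce
qed

subsection \<open>Words of the columns weakly to the right of a given column\<close>

definition col_word :: "nat \<Rightarrow> nat filling \<Rightarrow> nat list" where
  "col_word r T = reading_word (map (drop r) T)"

lemma col_word_simps [simp]:
  "col_word r [] = []"
  "col_word r (R # T) = col_word r T @ drop r R"
  "col_word r (S @ T) = col_word r T @ col_word r S"
  by (auto simp: col_word_def reading_word_def)

lemma set_col_word: "set (col_word r T) = (\<Union>R \<in> set T. set (drop r R))"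
  by (induction T) auto

lemma in_set_drop_conv_nth:
  "x \<in> set (drop r xs) \<longleftrightarrow> (\<exists>t. r \<le> t \<and> t < length xs \<and> xs ! t = x)"
proof
  assume "x \<in> set (drop r xs)"
  then obtain i where "i < length xs - r" "xs ! (r + i) = x" by (auto simp: in_set_conv_nth)
  then show "\<exists>t. r \<le> t \<and> t < length xs \<and> xs ! t = x" by (intro exI[of _ "r + i"]) auto
next
  assume "\<exists>t. r \<le> t \<and> t < length xs \<and> xs ! t = x"
  then obtain t where "r \<le> t" "t < length xs" "xs ! t = x" by blast
  then show "x \<in> set (drop r xs)"
    unfolding in_set_conv_nth by (intro exI[of _ "t - r"]) auto
qed

lemma subseq_drop: "r \<le> s \<Longrightarrow> subseq (drop s xs) (drop r xs)"
  by (metis drop_drop le_add_diff_inverse2 suffix_drop suffix_imp_subseq)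

lemma subseq_col_word: "r \<le> s \<Longrightarrow> subseq (col_word s T) (col_word r T)"
  by (induction T) (auto intro!: list_emb_append_mono subseq_drop)

text \<open>This is \<open>D(T, b, r)\<close>, with columns counted from 0.\<close>

definition decr_len :: "nat \<Rightarrow> nat filling \<Rightarrow> nat \<Rightarrow> nat" where
  "decr_len b T r = longest_decr b (col_word r T)"

lemma decr_len_antimono: "r \<le> s \<Longrightarrow> decr_len b T s \<le> decr_len b T r"
  unfolding decr_len_def by (intro longest_decr_mono subseq_col_word)

definition col_len :: "nat filling \<Rightarrow> nat \<Rightarrow> nat" where
  "col_len T r = length (filter (\<lambda>R. r < length R) T)"

lemma col_len_simps [simp]:
  "col_len [] r = 0"
  "col_len (R # T) r = (if r < length R then Suc (col_len T r) else col_len T r)"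
  "col_len (S @ T) r = col_len S r + col_len T r"
  by (auto simp: col_len_def)

lemma col_len_cong: "map length S = map length T \<Longrightarrow> col_len S r = col_len T r"
proof -
  have *: "col_len U r = length (filter (\<lambda>l. r < l) (map length U))" for U
    by (simp add: col_len_def filter_map o_def)
  show "map length S = map length T \<Longrightarrow> col_len S r = col_len T r" by (simp only: *)
qed

lemma decr_sub_row:
  assumes "decr_sub b R u" "sorted R" shows "length u \<le> 1"
proof (rule ccontr)
  assume "\<not> length u \<le> 1"
  then obtain x y v where u: "u = x # y # v"
    by (metis One_nat_def Suc_leI le_numeral_extra(4) length_Cons list.exhaust list.size(3) not_less_eq_eq zero_le)
  then have "subseq [x, y] R" "x > y" using assms unfolding decr_sub_def
    by (auto intro: subseq_order.order_trans[rotated])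
  then obtain N where "[x, y] = nths R N" by (auto simp: subseq_conv_nths)
  then have "sorted [x, y]" using assms(2) by (metis sorted_nths)
  then show False using \<open>x > y\<close> by simp
qed

text \<open>A strictly decreasing word takes at most one letter from each weakly increasing row, and
  none from a row that ends before column \<open>r\<close>.\<close>

lemma decr_sub_col_word_le:
  assumes "\<forall>R \<in> set T. sorted R" "decr_sub b (col_word r T) u"
  shows "length u \<le> col_len T r"
  using assms
proof (induction T arbitrary: u)
  case Nil then show ?case by (cases u) (auto simp: decr_sub_def)
next
  case (Cons R T)
  from Cons.prems(2) obtain u1 u2 where u: "u = u1 @ u2" "decr_sub b (col_word r T) u1"
      "decr_sub b (drop r R) u2"
    by (auto simp: decr_sub_append_iff)
  have "length u2 \<le> 1" using decr_sub_row[OF u(3)] Cons.prems by (simp add: sorted_wrt_drop)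
  moreover have "u2 = []" if "\<not> r < length R"
    using u(3) that by (cases u2) (auto simp: decr_sub_def)
  moreover have "length u1 \<le> col_len T r" using Cons u by simp
  ultimately show ?case using u(1) by auto
qed

lemma decr_len_le_col_len: "ssyt T \<Longrightarrow> decr_len b T r \<le> col_len T r"
  unfolding decr_len_def by (rule longest_decr_leI, rule decr_sub_col_word_le) (auto simp: ssyt_iff)

subsection \<open>Growth of a tableau by a maximal letter\<close>

text \<open>
  Letters of a decreasing subword that lie in columns left of column \<open>s\<close> can be exchanged for
  letters one row further down, up to the row \<open>R\<close> of length \<open>s\<close> below the tableau.
\<close>

lemma decr_sub_shift:
  assumes "\<forall>S \<in> set T. sorted S" "sorted_wrt above T" "\<forall>S \<in> set T. above S R"
    "length R = s" "r \<le> s" "decr_sub b (col_word r T) v"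
  shows "decr_sub b (col_word s T) v \<or>
    (\<exists>t v'. r \<le> t \<and> t < s \<and> length v' = length v \<and> subseq v' (col_word r T) \<and>
       sorted_wrt (>) (R ! t # v') \<and> (\<forall>x \<in> set (R ! t # v'). b < x))"
  using assms
proof (induction T arbitrary: R v rule: rev_induct)
  case Nil
  then show ?case by (auto simp: decr_sub_def)
next
  case (snoc S T)
  have SR: "above S R" using snoc.prems by simp
  have TR: "\<forall>U \<in> set T. above U R" using snoc.prems by simp
  \<comment> \<open>The row \<open>S\<close>, cut to length \<open>s\<close>, takes the role of
    \<open>R\<close> for the rows above it.\<close>
  have TS: "\<forall>U \<in> set T. above U (take s S)"
    using snoc.prems by (auto simp: sorted_wrt_append above_def)
  have lS: "length (take s S) = s" using SR snoc.prems(4) by (simp add: above_def)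
  have T: "\<forall>S \<in> set T. sorted S" "sorted_wrt above T"
    using snoc.prems by (auto simp: sorted_wrt_append)
  obtain u1 u2 where u: "v = u1 @ u2" "decr_sub b (drop r S) u1" "decr_sub b (col_word r T) u2"
    "\<forall>x \<in> set u1. \<forall>y \<in> set u2. x > y"
    using snoc.prems(6) by (auto simp: decr_sub_append_iff)
  have "length u1 \<le> 1"
    using decr_sub_row[OF u(2)] snoc.prems(1) by (simp add: sorted_wrt_drop)
  then consider "u1 = []" | z where "u1 = [z]" by (cases u1) auto
  then show ?case
  proof cases
    case 1
    show ?thesis
      using snoc.IH[OF T TR snoc.prems(4,5) u(3)] u 1
      by (auto intro: list_emb_append2 decr_sub_subseq)
  next
    case (2 z)
    then have zS: "z \<in> set (drop r S)" and bz: "b < z"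
      using u(2) by (auto simp: decr_sub_def subseq_singleton_left)
    then obtain t where t: "r \<le> t" "t < length S" "S ! t = z"
      by (auto simp: in_set_drop_conv_nth)
    show ?thesis
    proof (cases "t < s")
      case True
      \<comment> \<open>The entry of \<open>R\<close> in the column of \<open>z\<close> can be put
        in front of the unchanged \<open>v\<close>.\<close>
      then have "R ! t > z" using SR t snoc.prems(4) by (auto simp: above_def)
      have *: "length v = length v" "subseq v (col_word r (T @ [S]))"
          "sorted_wrt (>) (R ! t # v)" "\<forall>x \<in> set (R ! t # v). b < x"
        using snoc.prems(6) \<open>R ! t > z\<close> u 2 bz by (auto simp: decr_sub_def)
      show ?thesis using * t(1) True by blast
    next
      case False
      have "z \<in> set (drop s S)" using t False by (auto simp: in_set_drop_conv_nth intro!: exI[of _ t])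
      \<comment> \<open>Here \<open>z\<close> stays if the rest lies in columns from
        \<open>s\<close> on; otherwise \<open>S ! t'\<close> replaces \<open>z\<close>, and
        \<open>R ! t'\<close> is put in front.\<close>
      from snoc.IH[OF T TS lS snoc.prems(5) u(3)] show ?thesis
      proof (elim disjE exE conjE)
        assume "decr_sub b (col_word s T) u2"
        moreover have "decr_sub b (drop s S) u1"
          using 2 \<open>z \<in> set (drop s S)\<close> bz by (simp add: decr_sub_def subseq_singleton_left)
        ultimately have "decr_sub b (col_word s (T @ [S])) v"
          using u(1,4) by (auto simp: decr_sub_append_iff)
        then show ?thesis by blast
      next
        fix t' v' assume *: "r \<le> t'" "t' < s" "length v' = length u2" "subseq v' (col_word r T)"
          "sorted_wrt (>) (take s S ! t' # v')" "\<forall>x \<in> set (take s S ! t' # v'). b < x"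
        have "R ! t' > S ! t'" using SR * snoc.prems(4) by (auto simp: above_def)
        have "S ! t' \<in> set (drop r S)" using * lS
          by (auto simp: in_set_drop_conv_nth intro!: exI[of _ t'])
        then have "subseq (S ! t' # v') (col_word r (T @ [S]))"
          using *(4) list_emb_append_mono[of "(=)" "[S ! t']" "drop r S" v' "col_word r T"]
          by (simp add: subseq_singleton_left)
        moreover have "length (S ! t' # v') = length v" using *(3) u(1) 2 by simp
        moreover have "take s S ! t' = S ! t'" using *(2) by simp
        then have "sorted_wrt (>) (S ! t' # v')" "\<forall>x \<in> set (S ! t' # v'). b < x"
          using *(5,6) by auto
        then have "sorted_wrt (>) (R ! t' # S ! t' # v')" "\<forall>x \<in> set (R ! t' # S ! t' # v'). b < x"
          using \<open>R ! t' > S ! t'\<close> by auto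
        ultimately have "subseq (S ! t' # v') (col_word r (T @ [S]))" "length (S ! t' # v') = length v"
          "sorted_wrt (>) (R ! t' # S ! t' # v')" "\<forall>x \<in> set (R ! t' # S ! t' # v'). b < x"
          by blast+
        then show ?thesis using *(1,2) by blast
      qed
    qed
  qed
qed


text \<open>The default 0 covers \<open>k = length T\<close>: a cell opening a new row lies in
  column 0, so \<open>row_len T k\<close> is always the column of a cell added to row
  \<open>k\<close>.\<close>

definition row_len :: "nat filling \<Rightarrow> nat \<Rightarrow> nat" where
  "row_len T k = (if k < length T then length (T ! k) else 0)"

text \<open>A cell with letter \<open>i\<close> may be added to row \<open>k\<close> as the last one
  in the standard order of cells: it sits at an outer corner, \<open>i\<close> is a largest letter,
  and earlier copies of \<open>i\<close> lie strictly further left.\<close>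

definition grows :: "nat \<Rightarrow> nat \<Rightarrow> nat filling \<Rightarrow> bool" where
  "grows i k T \<longleftrightarrow> ssyt T \<and> k \<le> length T \<and> (0 < k \<longrightarrow> row_len T k < row_len T (k - 1)) \<and>
     (\<forall>R \<in> set T. \<forall>x \<in> set R. x \<le> i) \<and>
     (\<forall>R \<in> set T. \<forall>x \<in> set (drop (row_len T k) R). x < i)"

lemma above_snoc_iff:
  "above X (R @ [i]) \<longleftrightarrow> above X R \<and> length R < length X \<and> X ! length R < i"
proof -
  have "(\<forall>j < Suc (length R). X ! j < (R @ [i]) ! j) \<longleftrightarrow>
      (\<forall>j < length R. X ! j < R ! j) \<and> X ! length R < i"
    by (auto simp: nth_append less_Suc_eq)
  then show ?thesis by (auto simp: above_def)
qed

text \<open>One normal form for both kinds of growth: \<open>R = []\<close> stands for opening a new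
  row, and then nothing lies below.\<close>

lemma grows_split:
  assumes "grows i k T"
  obtains S R U where "length S = k" "add_cell i k T = S @ (R @ [i]) # U" "row_len T k = length R"
    "T = (if R = [] then S else S @ R # U)" "R = [] \<longrightarrow> U = []"
    "\<forall>X \<in> set S. sorted X \<and> X \<noteq> [] \<and> above X R \<and> length R < length X \<and> (\<forall>x \<in> set X. x \<le> i) \<and>
       (\<forall>x \<in> set (drop (length R) X). x < i)"
    "sorted_wrt above S" "sorted R" "\<forall>x \<in> set R. x \<le> i" "ssyt U" "\<forall>X \<in> set U. above R X"
    "\<forall>X \<in> set S. \<forall>Y \<in> set U. above X Y"
proof -
  have T: "ssyt T" and k: "k \<le> length T" using assms by (auto simp: grows_def)
  \<comment> \<open>Row \<open>k - 1\<close> is longer than row \<open>k\<close>, and the rows above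
    it are at least as long.\<close>
  have lt: "row_len T k < length X" if "X \<in> set (take k T)" for X
  proof -
    obtain p where p: "p < k" "X = T ! p" using \<open>X \<in> set (take k T)\<close> k
      by (auto simp: in_set_conv_nth)
    have "length (T ! (k - 1)) \<le> length X"
    proof (cases "p = k - 1")
      case False
      then have "above (T ! p) (T ! (k - 1))"
        using p k T unfolding ssyt_iff sorted_wrt_iff_nth_less by simp
      then show ?thesis using p by (simp add: above_def)
    qed (use p in simp)
    moreover have "row_len T k < length (T ! (k - 1))"
    proof -
      have "k - 1 < length T" "0 < k" using p k by auto
      then show ?thesis using assms by (simp add: grows_def row_len_def)
    qed
    ultimately show ?thesis by simp
  qed
  show ?thesis
  proof (cases "k = length T")
    case True
    show ?thesis
      by (rule that[of T "[]" "[]"])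
        (use True lt T assms in \<open>auto simp: grows_def add_cell_def row_len_def above_def ssyt_iff\<close>)
  next
    case False
    then have k': "k < length T" using k by simp
    define S R U where "S = take k T" and "R = T ! k" and "U = drop (Suc k) T"
    have eq: "T = S @ R # U" "length S = k"
      using k' by (simp_all add: S_def R_def U_def id_take_nth_drop)
    have ac: "add_cell i k T = S @ (R @ [i]) # U" and rl: "row_len T k = length R"
      using eq by (auto simp: add_cell_def row_len_def)
    show ?thesis
      by (rule that[of S R U])
        (use eq ac rl T lt assms in \<open>auto simp: ssyt_iff sorted_wrt_append grows_def\<close>)
  qed
qed

lemma ssyt_add_cell: "grows i k T \<Longrightarrow> ssyt (add_cell i k T)"
proof (elim grows_split)
  fix S R U
  assume *: "add_cell i k T = S @ (R @ [i]) # U" 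
    "\<forall>X \<in> set S. sorted X \<and> X \<noteq> [] \<and> above X R \<and> length R < length X \<and> (\<forall>x \<in> set X. x \<le> i) \<and>
       (\<forall>x \<in> set (drop (length R) X). x < i)"
    "sorted_wrt above S" "sorted R" "\<forall>x \<in> set R. x \<le> i" "ssyt U" "\<forall>X \<in> set U. above R X"
    "\<forall>X \<in> set S. \<forall>Y \<in> set U. above X Y"
  have "above X (R @ [i])" if "X \<in> set S" for X
  proof -
    have "length R < length X" using *(2) that by blast
    moreover from this have "X ! length R \<in> set (drop (length R) X)"
      by (auto simp: in_set_drop_conv_nth)
    ultimately have "X ! length R < i" "length R < length X" using *(2) that by auto
    then show ?thesis using *(2) that by (simp add: above_snoc_iff)
  qed
  moreover have "above (R @ [i]) X" if "X \<in> set U" for X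
    using *(7) that by (auto simp: above_def nth_append)
  ultimately show ?thesis using * by (auto simp: ssyt_iff sorted_wrt_append)
qed

lemma col_len_add_cell:
  assumes "grows i k T"
  shows "col_len (add_cell i k T) r = col_len T r + (if r = row_len T k then 1 else 0)"
  using assms by (elim grows_split) auto

lemma longest_decr_insert_mono: "longest_decr b (u @ v) \<le> longest_decr b (u @ x # v)"
  by (intro longest_decr_mono list_emb_append_mono) auto

text \<open>Only one letter of the word is new, so the value grows by at most one. At
  \<open>r = s\<close> the letter \<open>i\<close> heads the word and increases the value. Left of
  \<open>s\<close>, equality of the old values at \<open>r\<close> and \<open>s\<close> forces
  growth by monotonicity; otherwise \<open>decr_sub_shift\<close> excludes it.\<close>

lemma decr_len_add_cell:
  assumes "grows i k T" "b < i" and s: "s = row_len T k"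
  shows "decr_len b (add_cell i k T) r =
    decr_len b T r + (if r \<le> s \<and> decr_len b T r = decr_len b T s then 1 else 0)"
proof -
  obtain S R U where split: "length S = k" "add_cell i k T = S @ (R @ [i]) # U" "row_len T k = length R"
    "T = (if R = [] then S else S @ R # U)" "R = [] \<longrightarrow> U = []"
    "\<forall>X \<in> set S. sorted X \<and> X \<noteq> [] \<and> above X R \<and> length R < length X \<and> (\<forall>x \<in> set X. x \<le> i) \<and>
       (\<forall>x \<in> set (drop (length R) X). x < i)"
    "sorted_wrt above S" "sorted R" "\<forall>x \<in> set R. x \<le> i" "ssyt U" "\<forall>X \<in> set U. above R X"
    "\<forall>X \<in> set S. \<forall>Y \<in> set U. above X Y"
    using assms(1) by (rule grows_split)
  let ?T = "add_cell i k T"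
  have sR: "s = length R" using s split by simp
  have cw: "col_word r T = col_word r U @ drop r R @ col_word r S" for r
    using split(4,5) by auto
  have cw': "col_word r ?T = col_word r U @ drop r (R @ [i]) @ col_word r S" for r
    using split(2) by simp
  \<comment> \<open>No row below the new cell reaches column \<open>s\<close>.\<close>
  have U0: "col_word s U = []"
  proof -
    have "set (col_word s U) = {}"
      using split(11) sR by (auto simp: set_col_word above_def)
    then show ?thesis by simp
  qed
  have at_s: "decr_len b ?T s = Suc (decr_len b T s)"
  proof -
    have "y < i" if "y \<in> set (col_word s S)" for y
      using that split(6) sR by (auto simp: set_col_word)
    then show ?thesis
      using longest_decr_Cons_max[OF assms(2)] sR U0 by (simp add: decr_len_def cw cw')
  qed
  consider "s < r" | "r = s" | "r < s" by linarith
  then show ?thesis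
  proof cases
    case 1
    then show ?thesis using sR by (simp add: decr_len_def cw cw')
  next
    case 2
    then show ?thesis using at_s by simp
  next
    case 3
    let ?A = "col_word r U @ drop r R" and ?B = "col_word r S"
    have w: "col_word r T = ?A @ ?B" "col_word r ?T = ?A @ i # ?B"
      using 3 sR by (simp_all add: cw cw')
    have le1: "decr_len b T r \<le> decr_len b ?T r"
      using longest_decr_insert_mono[of b ?A ?B i] by (simp add: decr_len_def w)
    have le2: "decr_len b ?T r \<le> Suc (decr_len b T r)"
      using longest_decr_Cons_le[of b ?A i ?B] by (simp add: decr_len_def w)
    have mono: "decr_len b ?T s \<le> decr_len b ?T r" "decr_len b T s \<le> decr_len b T r"
      using 3 by (auto intro: decr_len_antimono)
    show ?thesis
    proof (cases "decr_len b T r = decr_len b T s")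
      case True
      then show ?thesis using le1 le2 mono at_s 3 by simp
    next
      case False
      then have gt: "decr_len b T s < decr_len b T r" using mono by simp
      have "decr_len b ?T r \<le> decr_len b T r"
      proof (rule ccontr)
        assume "\<not> decr_len b ?T r \<le> decr_len b T r"
        then have eq: "decr_len b ?T r = Suc (decr_len b T r)" using le2 by simp
        obtain u where u: "decr_sub b (col_word r ?T) u" "length u = Suc (decr_len b T r)"
          using eq by (metis decr_len_def longest_decr_attained)
        obtain u1 u2 where u12: "u = u1 @ u2" "decr_sub b ?A u1" "decr_sub b (i # ?B) u2"
          "\<forall>x \<in> set u1. \<forall>y \<in> set u2. x > y"
          using u(1) unfolding w decr_sub_append_iff by blast
        \<comment> \<open>A word avoiding \<open>i\<close> would already be a word of
          \<open>T\<close>, for which it is too long.\<close>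
        have "i \<in> set u2"
        proof (rule ccontr)
          assume "i \<notin> set u2"
          then have "decr_sub b ?B u2" using u12(3) unfolding decr_sub_def
            by (cases u2) (auto simp: list_emb_code split: if_splits)
          then have "decr_sub b (?A @ ?B) u" using u12 unfolding decr_sub_append_iff by blast
          then show False using decr_sub_length_le u(2) by (fastforce simp: decr_len_def w)
        qed
        have "x \<le> i" if "x \<in> set (?A @ i # ?B)" for x
        proof -
          have "x \<le> i" if "x \<in> set X" "X \<in> set T" for X
            using assms(1) that by (auto simp: grows_def)
          then show ?thesis
            using that split(4,5) by (fastforce simp: set_col_word dest: in_set_dropD split: if_splits)
        qed
        \<comment> \<open>No letter exceeds \<open>i\<close> and the word is strictly decreasing, so
          \<open>i\<close> comes first.\<close>
        then have "u1 = []" using u12(2,4) \<open>i \<in> set u2\<close>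
          by (cases u1) (fastforce dest: decr_sub_set)+
        have "\<exists>v. u2 = i # v"
        proof (cases u2)
          case (Cons a v)
          have "a \<le> i" using \<open>\<And>x. x \<in> set (?A @ i # ?B) \<Longrightarrow> x \<le> i\<close> u12(3) Cons
            by (fastforce dest: decr_sub_set)
          then show ?thesis using Cons \<open>i \<in> set u2\<close> u12(3) by (auto simp: decr_sub_def)
        qed (use \<open>i \<in> set u2\<close> in simp)
        then obtain v where v: "u2 = i # v" by blast
        have vB: "decr_sub b ?B v" using u12(3) v by (auto simp: decr_sub_def)
        have lv: "length v = decr_len b T r" using u(2) u12(1) \<open>u1 = []\<close> v by simp
        \<comment> \<open>Either the tail \<open>v\<close> lies in columns from \<open>s\<close> on,
          where it is too long, or a letter of \<open>R\<close> extends a word of the same length,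
          giving a word too long for \<open>T\<close>.\<close>
        have "decr_sub b (col_word s S) v \<or>
          (\<exists>t v'. r \<le> t \<and> t < s \<and> length v' = length v \<and> subseq v' (col_word r S) \<and>
            sorted_wrt (>) (R ! t # v') \<and> (\<forall>x \<in> set (R ! t # v'). b < x))"
          by (rule decr_sub_shift) (use split 3 sR vB in auto)
        then show False
        proof (elim disjE exE conjE)
          assume "decr_sub b (col_word s S) v"
          then have "length v \<le> decr_len b T s"
            using decr_sub_length_le U0 sR by (simp add: decr_len_def cw)
          then show False using gt lv by simp
        next
          fix t v' assume t: "r \<le> t" "t < s" "length v' = length v" "subseq v' (col_word r S)"
            "sorted_wrt (>) (R ! t # v')" "\<forall>x \<in> set (R ! t # v'). b < x"
          have "R ! t \<in> set (drop r R)" using t sR by (auto simp: in_set_drop_conv_nth intro!: exI[of _ t])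
          then have "subseq ([R ! t] @ v') (drop r R @ col_word r S)"
            using t by (intro list_emb_append_mono) (auto simp: subseq_singleton_left)
          then have "decr_sub b (col_word r T) (R ! t # v')"
            using t by (auto simp: decr_sub_def cw)
          then show False using decr_sub_length_le lv t(3) by (fastforce simp: decr_len_def)
        qed
      qed
      then show ?thesis using le1 False by simp
    qed
  qed
qed

lemma decr_len_eq_0: "(\<And>R x. R \<in> set T \<Longrightarrow> x \<in> set R \<Longrightarrow> x \<le> b) \<Longrightarrow> decr_len b T r = 0"
  unfolding decr_len_def
  by (rule longest_decr_eq_0) (auto simp: set_col_word dest: in_set_dropD)

lemma set_add_cell: "grows i k T \<Longrightarrow> \<Union> (set ` set (add_cell i k T)) = insert i (\<Union> (set ` set T))"
  by (elim grows_split) auto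

lemma grows_le:
  assumes "grows i k T" "R \<in> set (add_cell i k T)" "x \<in> set R" shows "x \<le> i"
proof -
  have "x \<in> insert i (\<Union> (set ` set T))"
    using assms unfolding set_add_cell[OF assms(1), symmetric] by blast
  then show ?thesis using assms(1) unfolding grows_def by blast
qed

lemma decr_len_add_cell_eq_0: "grows i k T \<Longrightarrow> \<not> b < i \<Longrightarrow> decr_len b (add_cell i k T) r = 0"
  using grows_le by (intro decr_len_eq_0) fastforce

text \<open>The cell to remove is at the end of the topmost row that ends in the largest letter
  \<open>i\<close>; it holds the rightmost copy of \<open>i\<close>.\<close>

lemma ssyt_grows:
  assumes "ssyt T" "T \<noteq> []"
  obtains i k T' where "grows i k T'" "T = add_cell i k T'"
proof -
  define i where "i = Max (\<Union> (set ` set T))"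
  have ne: "\<Union> (set ` set T) \<noteq> {}"
    using assms by (cases T) (auto simp: ssyt_Cons)
  have le: "x \<le> i" if "R \<in> set T" "x \<in> set R" for R x
    unfolding i_def by (intro Max_ge) (use that in auto)
  have "i \<in> \<Union> (set ` set T)" unfolding i_def by (intro Max_in ne) auto
  then obtain R where R: "R \<in> set T" "i \<in> set R" by blast
  have le_last: "x \<le> last R" if "R \<in> set T" "x \<in> set R" for R x
  proof -
    have "sorted R" using assms that by (auto simp: ssyt_iff)
    then show ?thesis using that(2)
      by (metis sorted_append append_butlast_last_id empty_iff in_set_butlastD
          list.set(1) list.set_intros(1) set_ConsD le_refl rotate1.simps(2) set_rotate1)
  qed
  have "last R = i" using R le le_last
    by (metis antisym empty_iff last_in_set list.set(1))
  then have "\<exists>k. k < length T \<and> last (T ! k) = i" using R by (metis in_set_conv_nth)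
  then obtain k where "k < length T \<and> last (T ! k) = i"
      "\<forall>p < k. \<not> (p < length T \<and> last (T ! p) = i)"
    using exists_least_iff[of "\<lambda>k. k < length T \<and> last (T ! k) = i"] by blast
  then have k: "k < length T" "last (T ! k) = i" "\<And>p. p < k \<Longrightarrow> last (T ! p) \<noteq> i"
    by auto
  define S where "S = take k T"
  define Q where "Q = butlast (T ! k)"
  define U where "U = drop (Suc k) T"
  have "T ! k \<noteq> []" using assms(1) nth_mem[OF k(1)] by (auto simp: ssyt_iff)
  then have T: "T = S @ (Q @ [i]) # U" unfolding S_def Q_def U_def
    using k by (metis append_butlast_last_id id_take_nth_drop)
  have ss: "sorted Q" "ssyt U" "\<forall>X \<in> set U. above (Q @ [i]) X" "\<forall>X \<in> set S. above X (Q @ [i])"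
    "ssyt S" "\<forall>X \<in> set S. \<forall>Y \<in> set U. above X Y"
    using assms(1) unfolding T by (auto simp: ssyt_iff sorted_wrt_append)
  \<comment> \<open>A longer row below would have an entry above \<open>i\<close> in the column of
    the removed cell.\<close>
  have lU: "length X \<le> length Q" if "X \<in> set U" for X
  proof (rule ccontr)
    assume "\<not> length X \<le> length Q"
    then have "length Q < length X" by simp
    then have "(Q @ [i]) ! length Q < X ! length Q" using ss(3) that unfolding above_def by blast
    moreover have "X ! length Q \<in> set X" using \<open>\<not> length X \<le> length Q\<close> by simp
    then have "X ! length Q \<le> i" using le[of X] that by (auto simp: T)
    ultimately show False by simp
  qed
  \<comment> \<open>Rows above end in a letter other than \<open>i\<close>, hence contain no
    \<open>i\<close>.\<close>
  have S: "x < i" if X: "X \<in> set S" "x \<in> set X" for X x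
  proof -
    obtain p where p: "p < k" "X = T ! p" using X(1) k by (auto simp: S_def in_set_conv_nth)
    have XT: "X \<in> set T" "X \<noteq> []" using X T by auto
    have "last X \<noteq> i" using k(3) p by blast
    moreover have "last X \<le> i" using le[OF XT(1)] XT(2) by simp
    moreover have "x \<le> last X" using le_last[OF XT(1)] X by simp
    ultimately show ?thesis by simp
  qed
  have lS: "length Q < length X" if "X \<in> set S" for X using ss(4) that by (auto simp: above_def)
  have U0: "U = []" if "Q = []"
    using lU that assms(1) by (cases U) (auto simp: T ssyt_iff)
  define T' where "T' = (if Q = [] then S else S @ Q # U)"
  have lSk: "length S = k" using k by (simp add: S_def)
  have rl: "row_len T' k = length Q" using lSk by (auto simp: row_len_def T'_def)
  have above: "above X Q" if "X \<in> set S" for X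
    using ss(4) that by (simp add: above_snoc_iff)
  have above2: "above Q X" if "X \<in> set U" for X
    using ss(3) lU[OF that] that by (auto simp: above_def nth_append)
  have "ssyt T'"
    using ss above above2 assms(1)[unfolded T] unfolding T'_def by (auto simp: ssyt_iff sorted_wrt_append)
  moreover have "k \<le> length T'" using lSk by (simp add: T'_def)
  moreover have "row_len T' k < row_len T' (k - 1)" if "0 < k"
  proof -
    have "row_len T' (k - 1) = length (S ! (k - 1))"
      using that lSk by (simp add: T'_def row_len_def nth_append)
    then show ?thesis using lS that lSk rl by simp
  qed
  moreover have "\<forall>R \<in> set T'. \<forall>x \<in> set R. x \<le> i"
    using le le[of "Q @ [i]"] by (auto simp: T'_def T)
  moreover have "\<forall>R \<in> set T'. \<forall>x \<in> set (drop (length Q) R). x < i"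
    using S lU by (auto simp: T'_def dest: in_set_dropD)
  ultimately have "grows i k T'" by (simp add: grows_def rl)
  moreover have "T = add_cell i k T'"
    using U0 lSk by (auto simp: T add_cell_def T'_def)
  ultimately show ?thesis by (rule that)
qed

text \<open>Builds a tableau in the order of its letters, equal letters from left to right, so that
  statements on \<open>decr_len\<close> reduce to the growth rule
  \<open>decr_len_add_cell\<close>.\<close>

lemma ssyt_induct [consumes 1, case_names Nil add_cell]:
  assumes "ssyt T" "P []" "\<And>i k T. grows i k T \<Longrightarrow> P T \<Longrightarrow> P (add_cell i k T)"
  shows "P T"
  using assms(1)
proof (induction "length (concat T)" arbitrary: T rule: less_induct)
  case less
  show ?case
  proof (cases "T = []")
    case False
    obtain i k T' where T': "grows i k T'" "T = add_cell i k T'"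
      using ssyt_grows[OF less.prems False] .
    have "length (concat T') < length (concat T)"
      using T'(1) unfolding T'(2) by (rule grows_split) auto
    then have "P T'" using less.hyps T'(1) by (auto simp: grows_def)
    then show ?thesis using assms(3) T' by simp
  qed (use assms(2) in simp)
qed

section \<open>Monotonicity in the column and in the threshold\<close>

lemma col_len_antimono: "r \<le> s \<Longrightarrow> col_len T s \<le> col_len T r"
  by (induction T) auto

text \<open>Row \<open>k\<close> has a cell in column \<open>r\<close> but none in column
  \<open>row_len T k\<close>.\<close>

lemma col_len_row_len_less:
  assumes "grows i k T" "r < row_len T k" shows "col_len T (row_len T k) < col_len T r"
proof -
  obtain S R U where split: "length S = k" "add_cell i k T = S @ (R @ [i]) # U" "row_len T k = length R"
    "T = (if R = [] then S else S @ R # U)" 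
    using assms(1) by (rule grows_split) 
  then show ?thesis
    using assms(2) col_len_antimono[of r "length R" S] col_len_antimono[of r "length R" U]
    by (auto split: if_splits)
qed

text \<open>For positive entries, \<open>col_len T r - decr_len b T r\<close> counts the letters at
  most \<open>b\<close> in column \<open>r\<close> of the right key. The critical case of the
  induction is \<open>r < q < s\<close> for the column \<open>q\<close> of the new cell: column
  \<open>r\<close> is strictly longer than column \<open>q\<close>, which makes up for the growth at
  \<open>r\<close>.\<close>

lemma decr_len_complement_antimono:
  assumes "ssyt T" "r \<le> s"
  shows "decr_len b T r + col_len T s \<le> decr_len b T s + col_len T r"
  using assms
proof (induction arbitrary: r s rule: ssyt_induct)
  case Nil
  then show ?case by (simp add: decr_len_def)
next
  case (add_cell i k T)
  show ?case
  proof (cases "b < i")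
    case True
    have "decr_len b T s \<le> decr_len b T r" using add_cell by (intro decr_len_antimono)
    moreover have "decr_len b T s \<le> decr_len b T (row_len T k)" if "row_len T k \<le> s"
      using that by (intro decr_len_antimono)
    moreover have "decr_len b T (row_len T k) \<le> decr_len b T r" if "r \<le> row_len T k"
      using that by (intro decr_len_antimono)
    moreover have "decr_len b T (row_len T k) \<le> decr_len b T s" if "s \<le> row_len T k"
      using that by (intro decr_len_antimono)
    ultimately show ?thesis
      using add_cell.hyps add_cell.IH[OF add_cell.prems] add_cell.IH[of "row_len T k" s] add_cell.prems
        col_len_row_len_less[of i k T r]
      unfolding decr_len_add_cell[OF add_cell.hyps True refl] col_len_add_cell[OF add_cell.hyps]
      by (cases "s \<le> row_len T k"; cases "r \<le> row_len T k"; cases "r = row_len T k";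
          cases "s = row_len T k") (auto split: if_splits)
  next
    case False
    then show ?thesis
      using decr_len_add_cell_eq_0[OF add_cell(1)] col_len_antimono[OF add_cell.prems] by simp
  qed
qed

text \<open>The difference \<open>decr_len b T r - decr_len b' T r\<close> will count the letters of
  key column \<open>r\<close> from \<open>b + 1\<close> to \<open>b'\<close>; the case
  \<open>b = x - 1\<close>, \<open>b' = x\<close> yields nested key columns. If the added letter is
  at most \<open>b'\<close>, the terms for \<open>b'\<close> vanish and monotonicity
  suffices.\<close>

lemma decr_len_differences:
  assumes "ssyt T" "b \<le> b'" "r \<le> s"
  shows "decr_len b' T r + decr_len b T s \<le> decr_len b T r + decr_len b' T s"
  using assms
proof (induction arbitrary: r s rule: ssyt_induct)
  case Nil
  then show ?case by (simp add: decr_len_def)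
next
  case (add_cell i k T)
  let ?q = "row_len T k"
  have mono: "r \<le> s \<Longrightarrow> decr_len b T s \<le> decr_len b T r" for b r s
    by (rule decr_len_antimono)
  show ?case
  proof (cases "b' < i")
    case True
    then have b: "b < i" using add_cell by simp
    note IH = add_cell.IH[OF \<open>b \<le> b'\<close>]
    have "r \<le> s" by fact
    then show ?thesis
      using IH[of r s] IH[of s ?q] IH[of ?q s] mono[of r s b] mono[of r s b'] mono[of ?q s b]
        mono[of ?q s b'] mono[of r ?q b] mono[of r ?q b'] mono[of s ?q b] mono[of s ?q b']
      unfolding decr_len_add_cell[OF add_cell(1) True refl] decr_len_add_cell[OF add_cell(1) b refl]
      by (cases "s \<le> ?q"; cases "r \<le> ?q") (auto split: if_splits)
  next
    case False
    then show ?thesis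
      using decr_len_add_cell_eq_0[OF add_cell(1)] decr_len_antimono[OF add_cell.prems(2)] by simp
  qed
qed


subsection \<open>Row insertion\<close>

text \<open>\<open>ins x T T' k s\<close>: inserting \<open>x\<close> into \<open>T\<close> yields \<open>T'\<close>, whose new cell is in row \<open>k\<close>, column \<open>s\<close>.\<close>

inductive ins :: "nat \<Rightarrow> nat filling \<Rightarrow> nat filling \<Rightarrow> nat \<Rightarrow> nat \<Rightarrow> bool" where
  Nil: "ins x [] [[x]] 0 0"
| append: "\<forall>z \<in> set R. z \<le> x \<Longrightarrow> ins x (R # T) ((R @ [x]) # T) 0 (length R)"
| bump: "\<forall>z \<in> set A. z \<le> x \<Longrightarrow> x < y \<Longrightarrow> ins y T T' k s \<Longrightarrow>
    ins x ((A @ y # B) # T) ((A @ x # B) # T') (Suc k) s"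

lemma bump_append: "\<forall>z \<in> set R. z \<le> x \<Longrightarrow> bump x R = (R @ [x], None)"
  by (induction R) auto

lemma bump_bump: "\<forall>z \<in> set A. z \<le> x \<Longrightarrow> x < y \<Longrightarrow> bump x (A @ y # B) = (A @ x # B, Some y)"
  by (induction A) auto

lemma row_cases:
  fixes x :: nat
  obtains (append) "\<forall>z \<in> set R. z \<le> x"
  | (bump) A y B where "R = A @ y # B" "\<forall>z \<in> set A. z \<le> x" "x < y"
proof (cases "\<forall>z \<in> set R. z \<le> x")
  case False
  then obtain A y B where "R = A @ y # B" "\<not> y \<le> x" "\<forall>z \<in> set A. \<not> \<not> z \<le> x"
    using split_list_first_prop[of R "\<lambda>z. \<not> z \<le> x"] by blast
  then show ?thesis using bump by auto
qed (use append in blast)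

lemma ins_row_insert: "ins x T T' k s \<Longrightarrow> row_insert x T = (T', k)"
  by (induction rule: ins.induct) (auto simp: bump_append bump_bump)

lemma row_insert_ins: obtains T' k s where "row_insert x T = (T', k)" "ins x T T' k s"
proof -
  have "\<exists>T' k s. ins x T T' k s"
  proof (induction T arbitrary: x)
    case Nil then show ?case using ins.Nil by blast
  next
    case (Cons R T)
    show ?case
    proof (cases R x rule: row_cases)
      case append then show ?thesis using ins.append by blast
    next
      case (bump A y B) then show ?thesis using Cons[of y] ins.bump by metis
    qed
  qed
  then show ?thesis using that ins_row_insert by blast
qed

lemma above_pivot: "above (A @ y # B) S \<Longrightarrow> length A < length S \<Longrightarrow> y < S ! length A"
  unfolding above_def by (metis nth_append_length)

text \<open>A bumped letter is smaller than all entries below its old place in that column, so the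
  hypothesis passes to the next row with that place instead of \<open>p\<close>.\<close>

lemma ins_col_le:
  assumes "ins x T T' k s" "ssyt T" "\<forall>R \<in> set T. p < length R \<longrightarrow> x < R ! p"
  shows "s \<le> p"
  using assms
proof (induction arbitrary: p rule: ins.induct)
  case (append R x T)
  then show ?case by (metis leD leI list.set_intros(1) nth_mem)
next
  case (bump A x y T T' k s B)
  have "length A \<le> p"
  proof (rule ccontr)
    assume "\<not> length A \<le> p"
    then have "p < length A" by simp
    then have "A ! p \<le> x" "x < A ! p" using bump.hyps(1) bump.prems(2) by (auto simp: nth_append)
    then show False by simp
  qed
  moreover have "s \<le> length A"
    using bump.prems(1) by (intro bump.IH) (auto simp: ssyt_Cons dest: above_pivot)
  ultimately show ?case by simp
qed simp

text \<open>The bumping path never moves to the right.\<close>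

lemma ins_bump_col_le: "ins y T T' k s \<Longrightarrow> ssyt ((A @ y # B) # T) \<Longrightarrow> s \<le> length A"
  by (erule ins_col_le) (auto simp: ssyt_Cons dest: above_pivot)

lemma ins_row_len: "ins x T T' k s \<Longrightarrow> s = row_len T k"
  by (induction rule: ins.induct) (auto simp: row_len_def)

lemma ins_corner: "ins x T T' k s \<Longrightarrow> ssyt T \<Longrightarrow> 0 < k \<Longrightarrow> s < row_len T (k - 1)"
proof (induction rule: ins.induct)
  case (bump A x y T T' k s B)
  have "s \<le> length A" using bump by (intro ins_bump_col_le) auto
  moreover have "s < row_len T (k - 1)" if "0 < k" using bump that by (auto simp: ssyt_Cons)
  ultimately show ?case by (cases k) (auto simp: row_len_def split: if_splits)
qed auto

text \<open>Stated for any \<open>Q\<close> of the shape of \<open>T\<close>, so that it applies to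
  the recording tableau.\<close>

lemma ins_shape:
  assumes "ins x T T' k s" "map length Q = map length T"
  shows "map length T' = map length (add_cell i k Q)"
  using assms
proof (induction arbitrary: Q rule: ins.induct)
  case (append R x T)
  then show ?case by (cases Q) (auto simp: add_cell_def)
next
  case (bump A x y T T' k s B)
  then obtain S U where Q: "Q = S # U" "length S = length (A @ y # B)" "map length U = map length T"
    by (cases Q) auto
  show ?case using bump.IH[OF Q(3)] Q by (auto simp: add_cell_def split: if_splits)
qed (auto simp: add_cell_def)

lemma ins_set: "ins x T T' k s \<Longrightarrow> \<Union> (set ` set T') = insert x (\<Union> (set ` set T))"
  by (induction rule: ins.induct) auto

lemma above_replace:
  assumes "above (A @ y # B) S" "x < y" shows "above (A @ x # B) S"
proof -
  have "(A @ x # B) ! j \<le> (A @ y # B) ! j" for j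
    using assms(2) by (auto simp: nth_append nth_Cons')
  then show ?thesis using assms(1) unfolding above_def by (auto intro: le_less_trans)
qed

text \<open>Only the first two rows need a comparison. The letter \<open>y\<close> enters the second
  row weakly left of its old place, where the entries of the new first row are smaller than
  \<open>y\<close>.\<close>

lemma ssyt_ins: "ins x T T' k s \<Longrightarrow> ssyt T \<Longrightarrow> ssyt T'"
proof (induction rule: ins.induct)
  case (append R x T)
  then show ?case by (auto simp: ssyt_Cons sorted_append above_def nth_append)
next
  case (bump A x y T T' k s B)
  have T: "ssyt T" and srt: "sorted (A @ y # B)" and ab: "\<forall>S \<in> set T. above (A @ y # B) S"
    using bump.prems by (auto simp: ssyt_Cons)
  have T': "ssyt T'" using bump.IH T .
  let ?R = "A @ x # B"
  have srt': "sorted ?R" using srt bump.hyps(1,2) by (fastforce simp: sorted_append)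
  have below: "?R ! j < y" if "j \<le> length A" for j
  proof (cases "j = length A")
    case False
    then have "A ! j \<le> x" using that bump.hyps(1) by simp
    then show ?thesis using that False bump.hyps(2) by (simp add: nth_append)
  qed (use bump.hyps(2) in simp)
  have "above ?R S'" if "T' = S' # U" for S' U
    using bump.hyps(3)
  proof cases
    case Nil
    then show ?thesis using that below[of 0] by (auto simp: above_def)
  next
    case (append S V)
    have "length S \<le> length A"
    proof (rule ccontr)
      assume *: "\<not> length S \<le> length A"
      then have "y < S ! length A" using ab append by (auto dest: above_pivot)
      moreover have "S ! length A \<le> y" using * append by simp
      ultimately show False by simp
    qed
    then show ?thesis
      using append that ab below above_replace[OF _ bump.hyps(2)] by (auto simp: above_snoc_iff)
  next
    case (bump C z V V' k' D)
    have "length C \<le> length A"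
    proof (rule ccontr)
      assume *: "\<not> length C \<le> length A"
      then have "y < (C @ z # D) ! length A" using ab bump by (intro above_pivot[of A y B]) auto
      then have "y < C ! length A" using * by (simp add: nth_append)
      moreover have "C ! length A \<le> y" using * bump by simp
      ultimately show False by simp
    qed
    have S: "above ?R (C @ z # D)" using ab bump above_replace[OF _ \<open>x < y\<close>] by simp
    have "?R ! j < (C @ y # D) ! j" if "j < length (C @ y # D)" for j
    proof (cases "j = length C")
      case True then show ?thesis using below \<open>length C \<le> length A\<close> by simp
    next
      case False
      then have "(C @ y # D) ! j = (C @ z # D) ! j" by (auto simp: nth_append nth_Cons')
      then show ?thesis using S that by (auto simp: above_def)
    qed
    then show ?thesis using S bump that by (auto simp: above_def)
  qed
  then show ?case
    using T' srt' by (cases T') (simp_all add: ssyt_Cons_Cons, simp add: ssyt_Cons)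
qed (simp add: ssyt_Cons)

subsection \<open>Decreasing subwords under row insertion\<close>

lemma decr_sub_singleton: "decr_sub b [x] u \<longleftrightarrow> u = [] \<or> u = [x] \<and> b < x"
  by (cases u) (auto simp: decr_sub_def list_emb_code)

lemma decr_sub_sorted:
  "sorted R \<Longrightarrow> decr_sub b R u \<longleftrightarrow> u = [] \<or> (\<exists>z \<in> set R. u = [z] \<and> b < z)"
proof -
  assume "sorted R"
  have "u = [] \<or> (\<exists>z \<in> set R. u = [z] \<and> b < z)" if "decr_sub b R u"
  proof (cases u)
    case (Cons z v)
    then show ?thesis using that decr_sub_row[OF that \<open>sorted R\<close>] decr_sub_set[OF that] by auto
  qed simp
  then show ?thesis by (auto simp: decr_sub_def subseq_singleton_left)
qed

lemma decr_sub_append4I: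
  assumes "decr_sub b W u1" "decr_sub b X u2" "decr_sub b Y u3" "decr_sub b V u4"
    "\<forall>p \<in> set u1. \<forall>q \<in> set u2 \<union> set u3 \<union> set u4. p > q"
    "\<forall>p \<in> set u2. \<forall>q \<in> set u3 \<union> set u4. p > q" "\<forall>p \<in> set u3. \<forall>q \<in> set u4. p > q"
  shows "decr_sub b (W @ X @ Y @ V) (u1 @ u2 @ u3 @ u4)"
  using assms unfolding decr_sub_def
  by (intro conjI list_emb_append_mono) (auto simp: sorted_wrt_append)

text \<open>The row followed by \<open>x\<close> and the letter \<open>y\<close> followed by the new
  row are Knuth equivalent. A decreasing subword uses at most one letter \<open>z\<close> of the
  row; if it uses \<open>x\<close> as well, then \<open>z \<ge> y\<close>, and \<open>z, x\<close>
  is exchanged for \<open>y, x\<close>. The words \<open>W\<close> and \<open>V\<close> are the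
  surrounding rows of a reading word.\<close>

lemma decr_sub_bumpI:
  assumes "sorted (A @ y # B)" "\<forall>z \<in> set A. z \<le> x" "x < y"
    and "decr_sub b (W @ (A @ y # B) @ [x] @ V) u"
  shows "\<exists>u'. length u' = length u \<and> decr_sub b (W @ [y] @ (A @ x # B) @ V) u'"
proof -
  let ?R = "A @ x # B"
  have R: "sorted ?R" using assms(1-3) by (fastforce simp: sorted_append)
  obtain u1 u2 u3 u4 where u: "u = u1 @ u2 @ u3 @ u4"
    "decr_sub b W u1" "decr_sub b (A @ y # B) u2" "decr_sub b [x] u3" "decr_sub b V u4"
    "\<forall>p \<in> set u1. \<forall>q \<in> set u2 \<union> set u3 \<union> set u4. p > q"
    "\<forall>p \<in> set u2. \<forall>q \<in> set u3 \<union> set u4. p > q" "\<forall>p \<in> set u3. \<forall>q \<in> set u4. p > q"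
    using assms(4) unfolding decr_sub_append_iff[of b W] decr_sub_append_iff[of b "A @ y # B"]
      decr_sub_append_iff[of b "[x]"] by force
  have glue: "\<exists>u'. length u' = length u \<and> decr_sub b (W @ [y] @ ?R @ V) u'"
    if "decr_sub b [y] v2" "decr_sub b ?R v3" "length v2 + length v3 = length u2 + length u3"
      "\<forall>p \<in> set u1. \<forall>q \<in> set v2 \<union> set v3. p > q"
      "\<forall>p \<in> set v2. \<forall>q \<in> set v3 \<union> set u4. p > q" "\<forall>p \<in> set v3. \<forall>q \<in> set u4. p > q" for v2 v3
  proof (intro exI conjI)
    show "length (u1 @ v2 @ v3 @ u4) = length u" using that(3) u(1) by simp
    show "decr_sub b (W @ [y] @ ?R @ V) (u1 @ v2 @ v3 @ u4)"
      by (rule decr_sub_append4I) (use that u(2,5,6) in auto)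
  qed
  from u(3) consider "u2 = []" | z where "u2 = [z]" "z \<in> set (A @ y # B)" "b < z"
    unfolding decr_sub_sorted[OF assms(1)] by blast
  then show ?thesis
  proof cases
    case 1
    show ?thesis
      by (rule glue[of "[]" u3]) (use u 1 in \<open>auto simp: decr_sub_singleton decr_sub_sorted[OF R]\<close>)
  next
    case (2 z)
    show ?thesis
    proof (cases "u3 = []")
      case True
      show ?thesis
      proof (cases "z = y")
        case True
        show ?thesis
          by (rule glue[of "[y]" "[]"])
            (use u 2 \<open>u3 = []\<close> True in \<open>auto simp: decr_sub_singleton decr_sub_sorted[OF R]\<close>)
      next
        case False
        show ?thesis
          by (rule glue[of "[]" "[z]"])
            (use u 2 \<open>u3 = []\<close> False in \<open>auto simp: decr_sub_singleton decr_sub_sorted[OF R]\<close>)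
      qed
    next
      case False
      then have u3: "u3 = [x]" "b < x" using u(4) by (auto simp: decr_sub_singleton)
      then have "x < z" using u(7) 2 by simp
      then have "y \<le> z" using 2(2) assms(1,2) by (fastforce simp: sorted_append)
      show ?thesis
        by (rule glue[of "[y]" "[x]"])
          (use u 2 u3 \<open>y \<le> z\<close> \<open>x < z\<close> assms(3) in
            \<open>force simp: decr_sub_singleton decr_sub_sorted[OF R]\<close>)+
    qed
  qed
qed

text \<open>The converse exchange: a row letter \<open>z\<close> used after \<open>y\<close> is
  smaller than \<open>y\<close>, hence at most \<open>x\<close>, and \<open>y, z\<close> becomes
  \<open>y, x\<close>.\<close>

lemma decr_sub_bumpD:
  assumes "sorted (A @ y # B)" "\<forall>z \<in> set A. z \<le> x" "x < y"
    and "decr_sub b (W @ [y] @ (A @ x # B) @ V) u"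
  shows "\<exists>u'. length u' = length u \<and> decr_sub b (W @ (A @ y # B) @ [x] @ V) u'"
proof -
  let ?R = "A @ x # B"
  have R: "sorted ?R" using assms(1-3) by (fastforce simp: sorted_append)
  obtain u1 u2 u3 u4 where u: "u = u1 @ u2 @ u3 @ u4"
    "decr_sub b W u1" "decr_sub b [y] u2" "decr_sub b ?R u3" "decr_sub b V u4"
    "\<forall>p \<in> set u1. \<forall>q \<in> set u2 \<union> set u3 \<union> set u4. p > q"
    "\<forall>p \<in> set u2. \<forall>q \<in> set u3 \<union> set u4. p > q" "\<forall>p \<in> set u3. \<forall>q \<in> set u4. p > q"
    using assms(4) unfolding decr_sub_append_iff[of b W] decr_sub_append_iff[of b ?R]
      decr_sub_append_iff[of b "[y]"] by force
  have glue: "\<exists>u'. length u' = length u \<and> decr_sub b (W @ (A @ y # B) @ [x] @ V) u'"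
    if "decr_sub b (A @ y # B) v2" "decr_sub b [x] v3" "length v2 + length v3 = length u2 + length u3"
      "\<forall>p \<in> set u1. \<forall>q \<in> set v2 \<union> set v3. p > q"
      "\<forall>p \<in> set v2. \<forall>q \<in> set v3 \<union> set u4. p > q" "\<forall>p \<in> set v3. \<forall>q \<in> set u4. p > q" for v2 v3
  proof (intro exI conjI)
    show "length (u1 @ v2 @ v3 @ u4) = length u" using that(3) u(1) by simp
    show "decr_sub b (W @ (A @ y # B) @ [x] @ V) (u1 @ v2 @ v3 @ u4)"
      by (rule decr_sub_append4I) (use that u(2,5,6) in auto)
  qed
  from u(4) consider "u3 = []" | z where "u3 = [z]" "z \<in> set ?R" "b < z"
    unfolding decr_sub_sorted[OF R] by blast
  then show ?thesis
  proof cases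
    case 1
    show ?thesis
      by (rule glue[of u2 "[]"])
        (use u 1 in \<open>auto simp: decr_sub_singleton decr_sub_sorted[OF assms(1)]\<close>)
  next
    case (2 z)
    show ?thesis
    proof (cases "u2 = []")
      case True
      show ?thesis
      proof (cases "z = x")
        case True
        show ?thesis
          by (rule glue[of "[]" "[x]"])
            (use u 2 \<open>u2 = []\<close> True in \<open>auto simp: decr_sub_singleton decr_sub_sorted[OF assms(1)]\<close>)
      next
        case False
        show ?thesis
          by (rule glue[of "[z]" "[]"])
            (use u 2 \<open>u2 = []\<close> False in \<open>auto simp: decr_sub_singleton decr_sub_sorted[OF assms(1)]\<close>)
      qed
    next
      case False
      then have u2: "u2 = [y]" "b < y" using u(3) by (auto simp: decr_sub_singleton)
      then have "z < y" using u(7) 2 by simp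
      then have "z \<le> x" using 2(2) assms(1,2) by (fastforce simp: sorted_append)
      show ?thesis
        by (rule glue[of "[y]" "[x]"])
          (use u 2 u2 \<open>z \<le> x\<close> assms(3) in
            \<open>force simp: decr_sub_singleton decr_sub_sorted[OF assms(1)]\<close>)+
    qed
  qed
qed


lemma longest_decr_le_transfer:
  assumes "\<And>u. decr_sub b w u \<Longrightarrow> \<exists>u'. length u' = length u \<and> decr_sub b w' u'"
  shows "longest_decr b w \<le> longest_decr b w'"
  by (rule longest_decr_leI) (metis assms decr_sub_length_le)

text \<open>The whole bumping path lies in columns from \<open>s \<ge> r\<close> on, so each bump is
  a Knuth equivalence of truncated rows. For the induction, \<open>V\<close> collects the rows above
  the current one.\<close>

lemma ins_decr_sub_left:
  assumes "ins x T T' k s" "ssyt T" "r \<le> s"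
  shows "longest_decr b (col_word r T @ x # V) = longest_decr b (col_word r T' @ V)"
  using assms
proof (induction arbitrary: V rule: ins.induct)
  case (bump A x y T T' k s B)
  have "s \<le> length A" using bump by (intro ins_bump_col_le) auto
  then have *: "drop r (A @ y # B) = drop r A @ y # B" "drop r (A @ x # B) = drop r A @ x # B"
    using bump.prems by auto
  have srt: "sorted (drop r A @ y # B)" using bump.prems(1) *(1)
    by (metis sorted_wrt_drop ssyt_Cons)
  have le: "\<forall>z \<in> set (drop r A). z \<le> x" using bump.hyps(1) by (auto dest: in_set_dropD)
  have "longest_decr b (col_word r T @ (drop r A @ y # B) @ [x] @ V) =
      longest_decr b (col_word r T @ [y] @ (drop r A @ x # B) @ V)"
    by (intro antisym longest_decr_le_transfer) (erule decr_sub_bumpI[OF srt le bump.hyps(2)]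
      decr_sub_bumpD[OF srt le bump.hyps(2)])+
  also have "\<dots> = longest_decr b (col_word r T' @ (drop r A @ x # B) @ V)"
    using bump.IH[of "(drop r A @ x # B) @ V"] bump.prems by (simp add: ssyt_Cons)
  finally show ?case using \<open>s \<le> length A\<close> bump.prems(2) by simp
qed auto

text \<open>The bumping path starts weakly left of column \<open>p\<close> and never moves right, so
  it misses the columns from \<open>r\<close> on.\<close>

lemma ins_col_word_eq:
  assumes "ins x T T' k s" "ssyt T" "\<forall>R \<in> set T. p < length R \<longrightarrow> x < R ! p" "p < r"
  shows "col_word r T' = col_word r T"
  using assms
proof (induction arbitrary: p rule: ins.induct)
  case (append R x T)
  have "length R \<le> p" using append by (metis leD leI list.set_intros(1) nth_mem)
  then show ?case using append.prems by simp
next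
  case (bump A x y T T' k s B)
  have "length A \<le> p"
  proof (rule ccontr)
    assume "\<not> length A \<le> p"
    then have "p < length A" by simp
    then have "A ! p \<le> x" "x < A ! p" using bump.hyps(1) bump.prems(2) by (auto simp: nth_append)
    then show False by simp
  qed
  moreover have "col_word r T' = col_word r T"
    using bump.prems \<open>length A \<le> p\<close>
    by (intro bump.IH[of "length A"]) (auto simp: ssyt_Cons dest: above_pivot)
  ultimately show ?case using bump.prems(3) by (simp add: drop_Cons')
qed simp

text \<open>The letters placed along the bumping path, read from the bottom up, strictly decrease
  and end with \<open>x\<close>; there is one in each row down to the new cell, in columns from
  \<open>s\<close> on.\<close>

lemma ins_bumping_path:
  assumes "ins x T T' k s" "ssyt T"
  shows "\<exists>u. subseq (u @ [x]) (col_word s T') \<and> sorted_wrt (>) (u @ [x]) \<and> length u = col_len T s"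
  using assms
proof (induction rule: ins.induct)
  case (append R x T)
  have "length S \<le> length R" if "S \<in> set T" for S
    using append.prems that by (simp add: ssyt_Cons above_def)
  then have "filter (\<lambda>S. length R < length S) T = []"
    by (auto simp: filter_empty_conv not_less)
  then have "col_len T (length R) = 0" by (simp add: col_len_def)
  then show ?case by (intro exI[of _ "[]"]) auto
next
  case (bump A x y T T' k s B)
  have s: "s \<le> length A" using bump by (intro ins_bump_col_le) auto
  obtain u where u: "subseq (u @ [y]) (col_word s T')" "sorted_wrt (>) (u @ [y])"
      "length u = col_len T s"
    using bump.IH bump.prems by (auto simp: ssyt_Cons)
  have "subseq ((u @ [y]) @ [x]) (col_word s T' @ drop s (A @ x # B))"
    using s by (intro list_emb_append_mono u) (simp add: subseq_singleton_left)
  moreover have "sorted_wrt (>) ((u @ [y]) @ [x])"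
    using u(2) bump.hyps(2) by (auto simp: sorted_wrt_append)
  ultimately show ?case using u(3) s by (intro exI[of _ "u @ [y]"]) simp
qed auto

text \<open>While the path is weakly right of column \<open>r\<close>, words are exchanged by
  \<open>decr_sub_bumpI\<close>. Further down the truncated rows do not change; if \<open>u\<close>
  uses the letter inserted there, its part up to that letter is replaced by the bumping path word,
  and the second alternative records the lengths.\<close>

lemma ins_decr_sub_right:
  assumes "ins x T T' k s" "ssyt T" "s < r" "decr_sub b (col_word r T @ x # V) u"
  shows "(\<exists>u'. length u' = length u \<and> decr_sub b (col_word r T' @ V) u') \<or>
    (\<exists>u'. decr_sub b (col_word s T' @ V) u' \<and>
       length u + col_len T s \<le> length u' + col_len T r)" (is "?P x T T' s V u \<or> ?Q x T T' s V u")
proof -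
  \<comment> \<open>Treats the rows from the first one on where the path is left of column
    \<open>r\<close>; \<open>x\<close> is the letter inserted there.\<close>
  have base: "?P x T T' s V u \<or> ?Q x T T' s V u"
    if i: "ins x T T' k s" "ssyt T" "decr_sub b (col_word r T @ x # V) u"
      "col_word r T' = col_word r T" for x T T' k V u s
  proof -
    obtain u1 v where v: "u = u1 @ v" "decr_sub b (col_word r T) u1" "decr_sub b ([x] @ V) v"
      "\<forall>p \<in> set u1. \<forall>q \<in> set v. p > q"
      using i(3) unfolding decr_sub_append_iff[of b "col_word r T"] by auto
    then obtain u2 u3 where u: "u = u1 @ u2 @ u3" "decr_sub b (col_word r T) u1"
      "decr_sub b [x] u2" "decr_sub b V u3"
      "\<forall>p \<in> set u1. \<forall>q \<in> set u2 \<union> set u3. p > q" "\<forall>p \<in> set u2. \<forall>q \<in> set u3. p > q"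
      using decr_sub_append_iff[of b "[x]" V v] by auto
    show ?thesis
    proof (cases "u2 = []")
      case True
      then have "decr_sub b (col_word r T' @ V) u"
        using u i(4) unfolding decr_sub_append_iff by auto
      then show ?thesis by blast
    next
      case False
      then have x: "u2 = [x]" "b < x" using u(3) by (auto simp: decr_sub_singleton)
      obtain v where v: "subseq (v @ [x]) (col_word s T')" "sorted_wrt (>) (v @ [x])"
          "length v = col_len T s"
        using ins_bumping_path[OF i(1,2)] by blast
      have "decr_sub b (col_word s T') (v @ [x])"
        using v x by (fastforce simp: decr_sub_def sorted_wrt_append)
      moreover have "\<forall>p \<in> set (v @ [x]). x \<le> p"
        using v(2) by (auto simp: sorted_wrt_append intro: less_imp_le)
      then have "\<forall>p \<in> set (v @ [x]). \<forall>q \<in> set u3. q < p"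
        using u(6) x(1) by (meson less_le_trans list.set_intros(1))
      ultimately have "decr_sub b (col_word s T' @ V) ((v @ [x]) @ u3)"
        using u(4) unfolding decr_sub_append_iff by blast
      moreover have "length u1 \<le> col_len T r"
        using i(2) u(2) by (intro decr_sub_col_word_le) (auto simp: ssyt_iff)
      then have "length u + col_len T s \<le> length ((v @ [x]) @ u3) + col_len T r"
        using u(1) v(3) x by simp
      ultimately show ?thesis by blast
    qed
  qed
  show ?thesis
    using assms
  proof (induction arbitrary: V u rule: ins.induct)
    case (Nil x)
    then show ?case by (intro base[OF ins.Nil]) auto
  next
    case (append R x T)
    then show ?case by (intro base[OF ins.append]) auto
  next
    case (bump A x y T T' k s B)
    have s: "s \<le> length A" using bump by (intro ins_bump_col_le) auto
    show ?case
    proof (cases "r \<le> length A")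
      case False
      have T: "ssyt T" "\<forall>R \<in> set T. length A < length R \<longrightarrow> y < R ! length A"
        using bump.prems(1) by (auto simp: ssyt_Cons dest: above_pivot)
      have "col_word r T' = col_word r T"
          using False by (intro ins_col_word_eq[OF bump.hyps(3) T]) simp
      then show ?thesis using False bump.prems bump.hyps
        by (intro base[OF ins.bump[OF bump.hyps(1-3)]]) (auto simp: drop_Cons')
    next
      case True
      then have *: "drop r (A @ y # B) = drop r A @ y # B" "drop r (A @ x # B) = drop r A @ x # B"
        by auto
      have srt: "sorted (drop r A @ y # B)" using bump.prems(1) *(1)
        by (metis sorted_wrt_drop ssyt_Cons)
      have le: "\<forall>z \<in> set (drop r A). z \<le> x" using bump.hyps(1) by (auto dest: in_set_dropD)
      have "decr_sub b (col_word r T @ (drop r A @ y # B) @ [x] @ V) u" using bump.prems(3) * by simp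
      then obtain v where v: "length v = length u"
          "decr_sub b (col_word r T @ y # ((drop r A @ x # B) @ V)) v"
        using decr_sub_bumpI[OF srt le bump.hyps(2)] by fastforce
      have len: "r < length (A @ y # B)" "s < length (A @ y # B)" using True bump.prems(2) by auto
      have "ssyt T" using bump.prems by (simp add: ssyt_Cons)
      from bump.IH[OF this bump.prems(2) v(2)] show ?thesis
      proof
        assume "\<exists>u'. length u' = length v \<and> decr_sub b (col_word r T' @ (drop r A @ x # B) @ V) u'"
        then show ?thesis using v(1) * by simp
      next
        assume "\<exists>u'. decr_sub b (col_word s T' @ (drop r A @ x # B) @ V) u' \<and>
            length v + col_len T s \<le> length u' + col_len T r"
        then obtain u' where u': "decr_sub b (col_word s T' @ (drop r A @ x # B) @ V) u'"
            "length v + col_len T s \<le> length u' + col_len T r" by blast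
        \<comment> \<open>The part of this row from column \<open>r\<close> on is enlarged to start
          at column \<open>s\<close>, as in the rows below.\<close>
        have "subseq (drop r (A @ x # B)) (drop s (A @ x # B))"
          using bump.prems(2) by (intro subseq_drop) simp
        then have "decr_sub b (col_word s T' @ drop s (A @ x # B) @ V) u'"
          using u'(1) unfolding *(2)[symmetric]
          by (elim decr_sub_subseq) (intro list_emb_append_mono subseq_order.order_refl)
        then show ?thesis using u'(2) len v(1) by (intro disjI2 exI[of _ u']) auto
      qed
    qed
  qed
qed

text \<open>At a bump left of column \<open>r\<close> the truncated rows agree, at others
  \<open>decr_sub_bumpD\<close> applies. This keeps \<open>decr_len b\<close> from growing when
  \<open>x \<le> b\<close>.\<close>

lemma ins_decr_sub_right_le:
  assumes "ins x T T' k s" "ssyt T" "decr_sub b (col_word r T' @ V) u"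
  shows "\<exists>u'. length u' = length u \<and> decr_sub b (col_word r T @ x # V) u'"
  using assms
proof (induction arbitrary: V u rule: ins.induct)
  case (Nil x)
  then have "decr_sub b (x # V) u" by (elim decr_sub_subseq) (auto simp: drop_Cons')
  then show ?case by auto
next
  case (append R x T)
  have "subseq (drop r (R @ [x])) (drop r R @ [x])" by (cases "r \<le> length R") auto
  then have "subseq (col_word r T @ drop r (R @ [x]) @ V) (col_word r T @ (drop r R @ [x]) @ V)"
    by (intro list_emb_append_mono) auto
  then show ?case using append.prems(2) decr_sub_subseq by fastforce
next
  case (bump A x y T T' k s B)
  have T: "ssyt T" using bump.prems by (simp add: ssyt_Cons)
  show ?case
  proof (cases "r \<le> length A")
    case False
    have "\<forall>R \<in> set T. length A < length R \<longrightarrow> y < R ! length A"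
      using bump.prems(1) by (auto simp: ssyt_Cons dest: above_pivot)
    then have "col_word r T' = col_word r T"
      using False by (intro ins_col_word_eq[OF bump.hyps(3) T, of "length A"]) simp_all
    then have eq: "col_word r ((A @ x # B) # T') = col_word r ((A @ y # B) # T)"
      using False by (simp add: drop_Cons')
    show ?thesis using bump.prems(2) unfolding eq
      by (intro exI[of _ u]) (auto elim!: decr_sub_subseq intro!: list_emb_append_mono)
  next
    case True
    then have *: "drop r (A @ y # B) = drop r A @ y # B" "drop r (A @ x # B) = drop r A @ x # B"
      by auto
    have srt: "sorted (drop r A @ y # B)" using bump.prems(1) *(1)
      by (metis sorted_wrt_drop ssyt_Cons)
    have le: "\<forall>z \<in> set (drop r A). z \<le> x" using bump.hyps(1) by (auto dest: in_set_dropD)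
    have "decr_sub b (col_word r T' @ ((drop r A @ x # B) @ V)) u" using bump.prems(2) * by simp
    then obtain v where "length v = length u"
        "decr_sub b (col_word r T @ [y] @ (drop r A @ x # B) @ V) v"
      using bump.IH[OF T] by fastforce
    then show ?thesis using decr_sub_bumpD[OF srt le bump.hyps(2), of b "col_word r T" V v] *
      by auto
  qed
qed

section \<open>Change of \<open>decr_len\<close> under insertion\<close>

lemma longest_decr_snoc_small: "x \<le> b \<Longrightarrow> longest_decr b (w @ [x]) = longest_decr b w"
proof (rule antisym)
  assume "x \<le> b"
  then have "\<exists>u'. length u' = length u \<and> decr_sub b w u'" if "decr_sub b (w @ [x]) u" for u
    using that unfolding decr_sub_append_iff by (auto simp: decr_sub_singleton)
  then show "longest_decr b (w @ [x]) \<le> longest_decr b w" by (rule longest_decr_le_transfer)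
qed (rule longest_decr_mono, auto)

text \<open>The bumping path word has \<open>col_len T s + 1\<close> letters, all at least
  \<open>x > b\<close>.\<close>

lemma decr_len_ins_large:
  assumes "ins x T T' k s" "ssyt T" "b < x"
  shows "col_len T s < decr_len b T' s"
proof -
  obtain u where u: "subseq (u @ [x]) (col_word s T')" "sorted_wrt (>) (u @ [x])" "length u = col_len T s"
    using ins_bumping_path[OF assms(1,2)] by blast
  then have "decr_sub b (col_word s T') (u @ [x])"
    using assms(3) by (fastforce simp: decr_sub_def sorted_wrt_append)
  from decr_sub_length_le[OF this] show ?thesis using u(3) by (simp add: decr_len_def)
qed

lemma decr_len_ins_left:
  assumes "ins x T T' k s" "ssyt T" "x \<le> b" "r \<le> s"
  shows "decr_len b T' r = decr_len b T r"
  using ins_decr_sub_left[OF assms(1,2,4), of b "[]"] assms(3)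
  by (simp add: decr_len_def longest_decr_snoc_small)

lemma decr_len_ins_le:
  assumes "ins x T T' k s" "ssyt T" "x \<le> b"
  shows "decr_len b T' r \<le> decr_len b T r"
proof -
  have "longest_decr b (col_word r T' @ []) \<le> longest_decr b (col_word r T @ [x])"
    by (intro longest_decr_le_transfer ins_decr_sub_right_le[OF assms(1,2)])
  then show ?thesis using assms(3) by (simp add: decr_len_def longest_decr_snoc_small)
qed

lemma decr_len_ins_right:
  assumes "ins x T T' k s" "ssyt T" "x \<le> b" "s < r"
  shows "decr_len b T' r = decr_len b T r \<or>
    decr_len b T r + col_len T s \<le> decr_len b T s + col_len T r"
proof -
  obtain u where u: "decr_sub b (col_word r T) u" "length u = decr_len b T r"
    unfolding decr_len_def by (rule longest_decr_attained)
  then have "decr_sub b (col_word r T @ x # []) u" by (elim decr_sub_subseq) auto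
  from ins_decr_sub_right[OF assms(1,2,4) this] show ?thesis
  proof (elim disjE exE conjE)
    fix u' assume "length u' = length u" "decr_sub b (col_word r T' @ []) u'"
    then have "decr_len b T r \<le> decr_len b T' r"
      using u decr_sub_length_le by (fastforce simp: decr_len_def)
    then show ?thesis using decr_len_ins_le[OF assms(1-3)] by (intro disjI1 antisym)
  next
    fix u' assume u': "decr_sub b (col_word s T' @ []) u'"
      "length u + col_len T s \<le> length u' + col_len T r"
    then have "length u' \<le> decr_len b T' s" using decr_sub_length_le by (simp add: decr_len_def)
    then show ?thesis using decr_len_ins_left[OF assms(1-3), of s] u u'(2) by simp
  qed
qed

subsection \<open>Successive insertions and their reversal\<close>

text \<open>First half of the row bumping lemma: \<open>x'\<close> passes all letters up to
  \<open>x\<close>, so it bumps some \<open>y' \<ge> y\<close> or is appended, and the comparison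
  continues one row down.\<close>

lemma ins_ins_le:
  assumes "ins x T T' k s" "ins x' T' T'' k' s'" "ssyt T" "x \<le> x'" shows "s < s'"
  using assms
proof (induction arbitrary: x' T'' k' s' rule: ins.induct)
  case (Nil x)
  from Nil(1) show ?case
  proof cases
    case (bump A y T' k B)
    then show ?thesis using Nil by (cases A) auto
  qed auto
next
  case (append R x T)
  from append.prems(1) show ?case
  proof cases
    case (bump A y T' k B)
    then have "y \<in> set (R @ [x])" by (metis in_set_conv_decomp)
    then have "y \<le> x" using append.hyps by auto
    then show ?thesis using append.prems bump by simp
  qed auto
next
  case (bump A x y T T' k s B)
  have s: "s \<le> length A" using bump by (intro ins_bump_col_le) auto
  from bump.prems(1) show ?case
  proof cases
    case append
    then show ?thesis using s by simp
  next
    case (bump A' y' U k'' B')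
    have le: "z \<le> x'" if "z \<in> set (A @ [x])" for z
      using that \<open>x \<le> x'\<close> \<open>\<forall>z \<in> set A. z \<le> x\<close> by auto
    have "y' \<notin> set (A @ [x])" using le \<open>x' < y'\<close> by force
    moreover from bump(1) obtain E where "A' = (A @ [x]) @ E \<and> E @ y' # B' = B \<or>
        A @ [x] = A' @ E \<and> y' # B' = E @ B"
      by (metis append_Cons append_Nil append_assoc append_eq_append_conv2)
    ultimately have "y' \<in> set B"
      by (cases E) (auto, metis Un_iff in_set_conv_decomp list.set_intros(1) set_ConsD set_append
        empty_iff list.set(1))
    then have "y \<le> y'" using bump.prems by (auto simp: ssyt_Cons sorted_append)
    then show ?thesis using bump.IH[OF bump(6)] bump.prems by (simp add: ssyt_Cons)
  qed
qed

text \<open>Second half of the row bumping lemma: \<open>x'\<close> bumps at or left of the place of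
  \<open>x\<close>, hence some \<open>y' < y\<close> when \<open>x\<close> has bumped
  \<open>y\<close>.\<close>

lemma ins_ins_gt:
  assumes "ins x T T' k s" "ins x' T' T'' k' s'" "ssyt T" "x' < x" shows "s' \<le> s"
  using assms
proof (induction arbitrary: x' T'' k' s' rule: ins.induct)
  case (Nil x)
  from Nil(1) show ?case
  proof cases
    case (bump A y U k'' B)
    from bump(6) have "ssyt [] \<Longrightarrow> s' \<le> 0" by cases auto
    then show ?thesis by simp
  qed (use Nil in auto)
next
  case (append R x T)
  from append.prems(1) show ?case
  proof cases
    case append
    then show ?thesis using \<open>x' < x\<close> by auto
  next
    case (bump A' y' U k'' B')
    have "length (R @ [x]) = length (A' @ y' # B')" using bump(1) by simp
    then have "length A' \<le> length R" by simp
    moreover have "s' \<le> length R"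
    proof (rule ins_col_le[OF bump(6)])
      show "ssyt T" using append.prems by (simp add: ssyt_Cons)
      have "length S \<le> length R" if "S \<in> set T" for S
        using append.prems that by (simp add: ssyt_Cons above_def)
      then show "\<forall>S \<in> set T. length R < length S \<longrightarrow> y' < S ! length R" by fastforce
    qed
    ultimately show ?thesis by simp
  qed
next
  case (bump A x y T T' k s B)
  from bump.prems(1) show ?case
  proof cases
    case append
    then show ?thesis using \<open>x' < x\<close> by auto
  next
    case (bump A' y' U k'' B')
    have "x \<in> set (A' @ y' # B')" using bump(1) by (metis in_set_conv_decomp)
    have "length A' \<le> length A"
    proof (rule ccontr)
      assume "\<not> length A' \<le> length A"
      then have "A' ! length A = x" using bump(1) by (metis not_le nth_append nth_append_length)
      then have "x \<in> set A'" using \<open>\<not> length A' \<le> length A\<close> by (metis not_le nth_mem)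
      then show False using bump \<open>x' < x\<close> by auto
    qed
    moreover have "(A @ x # B) ! length A' = y'" using bump(1) by (metis nth_append_length)
    ultimately have "y' \<in> set (A @ [x])"
      by (cases "length A' = length A") (auto simp: nth_append)
    then have "y' < y" using \<open>\<forall>z \<in> set A. z \<le> x\<close> \<open>x < y\<close> by auto
    then show ?thesis using bump.IH bump(6) bump.prems by (simp add: ssyt_Cons)
  qed
qed

text \<open>The row \<open>k\<close> of the new cell fixes the whole bumping path: going up, the
  letter to expel from a row is the last one smaller than the letter coming from below.\<close>

lemma ins_unique:
  assumes "ins x T T' k s" "ins x2 T2 T' k s2" "ssyt T" "ssyt T2"
  shows "x = x2 \<and> T = T2"
  using assms
proof (induction arbitrary: x2 T2 s2 rule: ins.induct)
  case (Nil x)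
  from Nil(1) show ?case by cases (use Nil in \<open>auto simp: ssyt_Cons\<close>)
next
  case (append R x T)
  from append.prems(1) show ?case by cases (use append in \<open>auto simp: ssyt_Cons\<close>)
next
  case (bump A x y T T' k s B)
  from bump.prems(1) show ?case
  proof cases
    case (bump A2 y2 T2' B2)
    have eq: "y = y2" "T = T2'"
      using bump.IH[OF bump(5)] bump.prems bump(1) by (auto simp: ssyt_Cons)
    \<comment> \<open>The new row and \<open>y\<close> alone determine where the row was
      split.\<close>
    have tw: "takeWhile (\<lambda>z. z < y) (C @ z # D) = C @ [z]"
      if "\<forall>u \<in> set C. u \<le> z" "z < y" "sorted (C @ y # D)" for C z D
    proof -
      have "takeWhile (\<lambda>z. z < y) D = []" using that(3) by (cases D) (auto simp: sorted_append)
      moreover have "\<forall>u \<in> set C. u < y" using that by auto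
      ultimately show ?thesis using that(2) by (simp add: takeWhile_append2)
    qed
    have "A @ [x] = A2 @ [x2]"
      using tw[of A x B] tw[of A2 x2 B2] bump bump.prems \<open>\<forall>z \<in> set A. z \<le> x\<close> \<open>x < y\<close> eq
      by (auto simp: ssyt_Cons)
    then show ?thesis using bump eq by simp
  qed
qed

text \<open>Reverse insertion; the hypothesis on the lower rows makes the last cell of row
  \<open>k\<close> a removable corner.\<close>

lemma ins_exists:
  assumes "ssyt T'" "k < length T'" "\<forall>S \<in> set (drop (Suc k) T'). length S < length (T' ! k)"
  shows "\<exists>x T. ssyt T \<and> ins x T T' k (length (T' ! k) - 1)"
  using assms
proof (induction T' arbitrary: k)
  case (Cons R' T')
  show ?case
  proof (cases k)
    case 0
    obtain R x where R': "R' = R @ [x]" using Cons.prems(1) by (metis rev_exhaust ssyt_Cons)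
    have len: "length S \<le> length R" if "S \<in> set T'" for S
      using Cons.prems(3) that 0 R' by auto
    show ?thesis
    proof (cases "R = []")
      case True
      have "T' = []" using len Cons.prems(1) True by (cases T') (auto simp: ssyt_Cons)
      then show ?thesis using 0 R' True ins.Nil by (intro exI[of _ x] exI[of _ "[]"]) simp
    next
      case False
      have "above R S" if "S \<in> set T'" for S
      proof -
        have "above (R @ [x]) S" using Cons.prems(1) that by (simp add: R' ssyt_Cons)
        then show ?thesis using len[OF that] unfolding above_def
          by (metis nth_append order_less_le_trans)
      qed
      then have "ssyt (R # T')" "\<forall>z \<in> set R. z \<le> x"
        using Cons.prems(1) False unfolding R' ssyt_Cons by (auto simp: sorted_append)
      then show ?thesis using 0 R' ins.append by (intro exI[of _ x] exI[of _ "R # T'"]) simp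
    qed
  next
    case (Suc k0)
    have T': "ssyt T'" and above: "\<forall>S \<in> set T'. above R' S" and srt: "sorted R'"
      using Cons.prems(1) by (auto simp: ssyt_Cons)
    define s where "s = length (T' ! k0) - 1"
    obtain y T where T: "ssyt T" "ins y T T' k0 s"
      using Cons.IH[of k0] Cons.prems Suc T' unfolding s_def by auto
    \<comment> \<open>The letter \<open>y\<close> coming up expels the last entry of
      \<open>?A\<close>.\<close>
    let ?A = "takeWhile (\<lambda>z. z < y) R'"
    obtain S' V' where S': "T' = S' # V'" using Cons.prems(2) Suc by (cases T') auto
    have aS': "above R' S'" using above S' by simp
    \<comment> \<open>\<open>q\<close> is the place of \<open>y\<close> in the row \<open>S'\<close>
      below; the bounds compare \<open>S'\<close> with the restored row \<open>S\<close>.\<close>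
    obtain q where q: "q < length S'" "S' ! q = y"
      "\<And>S V. T = S # V \<Longrightarrow> length S' \<le> Suc (length S) \<and> length S \<le> length S' \<and>
         (\<forall>p < length S. S' ! p \<le> S ! p) \<and> (\<forall>p < length S. q \<le> p \<longrightarrow> y < S ! p)"
    proof -
      from T(2) show ?thesis
      proof cases
        case Nil then show ?thesis using that[of 0] S' by auto
      next
        case (append S V)
        then show ?thesis using that[of "length S"] S' by (auto simp: nth_append)
      next
        case (bump C z V V'' k'' D)
        have "y < (C @ z # D) ! p" if "length C \<le> p" "p < length (C @ z # D)" for p
        proof -
          have "sorted (C @ z # D)" using T(1) bump by (simp add: ssyt_Cons)
          then have "(C @ z # D) ! length C \<le> (C @ z # D) ! p" using that by (rule sorted_nth_mono)
          then show ?thesis using bump by simp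
        qed
        moreover have "(C @ y # D) ! p \<le> (C @ z # D) ! p" for p
          using bump by (auto simp: nth_append nth_Cons')
        ultimately show ?thesis using that[of "length C"] S' bump by auto
      qed
    qed
    have "R' ! q < y" using aS' q(1,2) by (auto simp: above_def)
    have qR: "q < length R'" using aS' q(1) by (simp add: above_def)
    \<comment> \<open>The entry of \<open>R'\<close> above \<open>y\<close> is smaller than
      \<open>y\<close>, so \<open>?A\<close> is nonempty and reaches beyond
      \<open>q\<close>.\<close>
    have "q < length ?A"
    proof (rule ccontr)
      assume "\<not> q < length ?A"
      then have "length ?A \<le> q" by simp
      then have "R' ! length ?A \<le> R' ! q" using srt qR by (simp add: sorted_nth_mono)
      moreover have "\<not> R' ! length ?A < y"
        using nth_length_takeWhile[of "\<lambda>z. z < y" R'] \<open>length ?A \<le> q\<close> qR by simp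
      ultimately show False using \<open>R' ! q < y\<close> by simp
    qed
    then obtain A x where A: "?A = A @ [x]" by (metis less_nat_zero_code list.size(3) rev_exhaust)
    define B where "B = dropWhile (\<lambda>z. z < y) R'"
    have R': "R' = A @ x # B" using A unfolding B_def
      by (metis append.assoc append_Cons append_Nil takeWhile_dropWhile_id)
    have "x < y" using A by (metis in_set_conv_decomp set_takeWhileD)
    have B: "\<forall>z \<in> set B. y \<le> z"
    proof (cases B)
      case (Cons z D)
      then have "\<not> z < y" unfolding B_def by (metis dropWhile_eq_Cons_conv)
      then show ?thesis using srt Cons by (auto simp: R' sorted_append)
    qed simp
    have le: "\<forall>z \<in> set A. z \<le> x" using srt by (auto simp: R' sorted_append)
    have qA: "q \<le> length A" using \<open>q < length ?A\<close> A by simp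
    have "sorted (A @ y # B)" using srt B le \<open>x < y\<close> by (fastforce simp: R' sorted_append)
    \<comment> \<open>In column \<open>length A \<ge> q\<close> the entries of \<open>S\<close>
      exceed \<open>y\<close>; elsewhere \<open>R'\<close> is unchanged.\<close>
    moreover have "above (A @ y # B) S" if "T = S # V" for S V
    proof -
      have "(A @ y # B) ! j < S ! j" if "j < length S" for j
      proof (cases "j = length A")
        case True
        then show ?thesis using q(3)[OF \<open>T = S # V\<close>] qA \<open>j < length S\<close> by auto
      next
        case False
        then have "(A @ y # B) ! j = R' ! j" by (auto simp: R' nth_append nth_Cons')
        also have "\<dots> < S' ! j"
          using aS' q(3)[OF \<open>T = S # V\<close>] \<open>j < length S\<close> by (auto simp: above_def)
        also have "\<dots> \<le> S ! j" using q(3)[OF \<open>T = S # V\<close>] \<open>j < length S\<close> by auto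
        finally show ?thesis .
      qed
      moreover have "length S \<le> length (A @ y # B)"
        using q(3)[OF that] aS' by (auto simp: above_def R')
      ultimately show ?thesis by (simp add: above_def)
    qed
    ultimately have "ssyt ((A @ y # B) # T)"
      using T(1) by (cases T) (simp_all add: ssyt_Cons_Cons, simp add: ssyt_Cons)
    moreover have "ins x ((A @ y # B) # T) (R' # T') k s"
      using ins.bump[OF le \<open>x < y\<close> T(2)] Suc R' by simp
    ultimately show ?thesis using Suc by (auto simp: s_def)
  qed
qed simp


subsection \<open>The RSK correspondence\<close>

lemma lex_ordered_Nil [simp]: "lex_ordered []"
  by (simp add: lex_ordered_def)

lemma lex_ordered_snoc:
  "lex_ordered (w @ [p]) \<longleftrightarrow> lex_ordered w \<and> (w \<noteq> [] \<longrightarrow>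
     fst (last w) \<le> fst p \<and> (fst (last w) = fst p \<longrightarrow> snd (last w) \<le> snd p))"
proof (cases w rule: rev_cases)
  case (snoc v q)
  let ?R = "\<lambda>x y. fst x \<le> fst y \<and> (fst x = fst y \<longrightarrow> snd x \<le> snd y)"
  have "(\<forall>k. Suc k < length (w @ [p]) \<longrightarrow> ?R ((w @ [p]) ! k) ((w @ [p]) ! Suc k)) \<longleftrightarrow>
      (\<forall>k. Suc k < length w \<longrightarrow> ?R (w ! k) (w ! Suc k)) \<and> ?R q p" (is "?L \<longleftrightarrow> ?M")
  proof
    assume L: ?L
    have "?R (w ! k) (w ! Suc k)" if "Suc k < length w" for k
      using L[rule_format, of k] that by (simp add: nth_append)
    moreover have "?R q p" using L[rule_format, of "length v"] snoc by (simp add: nth_append)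
    ultimately show ?M by blast
  next
    assume M: ?M
    show ?L
    proof (intro allI impI)
      fix k assume k: "Suc k < length (w @ [p])"
      show "?R ((w @ [p]) ! k) ((w @ [p]) ! Suc k)"
      proof (cases "Suc k < length w")
        case True then show ?thesis using M by (simp add: nth_append)
      next
        case False
        then have "k = length v" using k snoc by simp
        then show ?thesis using M snoc by (simp add: nth_append)
      qed
    qed
  qed
  then show ?thesis unfolding lex_ordered_def using snoc by simp
qed (simp add: lex_ordered_def)

lemma lex_ordered_fst_le: "lex_ordered w \<Longrightarrow> b \<in> set w \<Longrightarrow> fst b \<le> fst (last w)"
proof (induction w rule: rev_induct)
  case (snoc p w)
  then show ?case by (cases "w = []") (fastforce simp: lex_ordered_snoc)+
qed simp

lemma RSK_snoc: "RSK (w @ [b]) = rsk_step (RSK w) b"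
  by (simp add: RSK_def)

lemma RSK_Nil [simp]: "RSK [] = ([], [])"
  by (simp add: RSK_def)

lemma row_len_cong: "map length S = map length T \<Longrightarrow> row_len S k = row_len T k"
  unfolding row_len_def by (metis length_map nth_map)

lemma ins_row_le: "ins x T T' k s \<Longrightarrow> k \<le> length T"
  by (induction rule: ins.induct) auto

lemma add_cell_new_cell:
  assumes "grows i k T"
  shows "\<exists>R \<in> set (add_cell i k T). i \<in> set (drop (row_len T k) R)"
    "\<forall>R \<in> set (add_cell i k T). \<forall>x \<in> set (drop (Suc (row_len T k)) R). x < i"
proof -
  obtain S R U where split: "add_cell i k T = S @ (R @ [i]) # U" "row_len T k = length R"
    "T = (if R = [] then S else S @ R # U)" "R = [] \<longrightarrow> U = []"
    using assms by (rule grows_split)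
  show "\<exists>R \<in> set (add_cell i k T). i \<in> set (drop (row_len T k) R)"
    using split(1,2) by auto
  have "x < i" if "X \<in> set S \<union> set U" "x \<in> set (drop (Suc (length R)) X)" for X x
  proof -
    have "X \<in> set T" using split(3,4) that(1) by auto
    moreover have "x \<in> set (drop (length R) X)"
      using that(2) set_drop_subset_set_drop[of "length R" "Suc (length R)" X] by auto
    ultimately show ?thesis using assms split(2) by (auto simp: grows_def)
  qed
  then show "\<forall>R \<in> set (add_cell i k T). \<forall>x \<in> set (drop (Suc (row_len T k)) R). x < i"
    using split(1,2) by auto
qed

lemma grows_ins:
  assumes "ins x P P' k s" "ssyt P" "ssyt Q" "map length P = map length Q"
    "\<forall>R \<in> set Q. \<forall>y \<in> set R. y \<le> i" "\<forall>R \<in> set Q. \<forall>y \<in> set (drop s R). y < i"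
  shows "grows i k Q"
proof -
  have "s = row_len Q k" using ins_row_len[OF assms(1)] row_len_cong[OF assms(4)] by simp
  moreover have "k \<le> length Q" using ins_row_le[OF assms(1)] assms(4) by (metis length_map)
  moreover have "0 < k \<longrightarrow> s < row_len Q (k - 1)"
    using ins_corner[OF assms(1,2)] row_len_cong[OF assms(4)] by simp
  ultimately show ?thesis using assms by (simp add: grows_def)
qed

text \<open>Each statement relies on the other. The clause on the last biletter says that its top
  letter has its rightmost copy in the column \<open>s\<close> of its cell; by
  \<open>ins_ins_le\<close> a next biletter with equal top gets a cell strictly further
  right.\<close>

lemma
  assumes "lex_ordered w" "RSK w = (P, Q)"
  shows RSK_invariants: "ssyt P \<and> ssyt Q \<and> map length P = map length Q \<and>
    \<Union> (set ` set P) = snd ` set w \<and> \<Union> (set ` set Q) = fst ` set w \<and>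
    (w \<noteq> [] \<longrightarrow> (\<exists>P0 k s. ssyt P0 \<and> ins (snd (last w)) P0 P k s \<and>
      (\<exists>R \<in> set Q. fst (last w) \<in> set (drop s R)) \<and>
      (\<forall>R \<in> set Q. \<forall>x \<in> set (drop (Suc s) R). x < fst (last w))))"
  and RSK_snoc_invariants: "lex_ordered (w @ [(i, j)]) \<Longrightarrow> \<exists>P' k s. ins j P P' k s \<and>
      RSK (w @ [(i, j)]) = (P', add_cell i k Q) \<and> grows i k Q \<and> s = row_len Q k"
proof -
  \<comment> \<open>The invariants are premises here, since this is used inside the induction that
    proves them and once more afterwards.\<close>
  have step: "\<exists>P' k s. ins j P P' k s \<and>
      RSK (w @ [(i, j)]) = (P', add_cell i k Q) \<and> grows i k Q \<and> s = row_len Q k"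
    if lex: "lex_ordered (w @ [(i, j)])" and R: "RSK w = (P, Q)" and
      inv: "ssyt P" "ssyt Q" "map length P = map length Q"
        "\<Union> (set ` set P) = snd ` set w" "\<Union> (set ` set Q) = fst ` set w"
        "w \<noteq> [] \<longrightarrow> (\<exists>P0 k s. ssyt P0 \<and> ins (snd (last w)) P0 P k s \<and>
          (\<exists>R \<in> set Q. fst (last w) \<in> set (drop s R)) \<and>
          (\<forall>R \<in> set Q. \<forall>x \<in> set (drop (Suc s) R). x < fst (last w)))" for w i j P Q
  proof -
    obtain P' k s where P': "row_insert j P = (P', k)" "ins j P P' k s" by (rule row_insert_ins)
    have le: "y \<le> fst (last w)" "w \<noteq> []" if "R \<in> set Q" "y \<in> set R" for R y
    proof -
      have "y \<in> fst ` set w" using that inv(5) by blast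
      then show "y \<le> fst (last w)" "w \<noteq> []"
        using lex lex_ordered_fst_le by (auto simp: lex_ordered_snoc)
    qed
    have last: "w \<noteq> [] \<Longrightarrow> fst (last w) \<le> i" using lex by (simp add: lex_ordered_snoc)
    \<comment> \<open>If \<open>i\<close> occurred before, its copies lie in columns up to
      \<open>s0\<close>, and the new column \<open>s\<close> exceeds \<open>s0\<close>.\<close>
    have "y < i" if "R \<in> set Q" "y \<in> set (drop s R)" for R y
    proof -
      have y: "y \<in> set R" using that(2) by (rule in_set_dropD)
      note w = le[OF that(1) y]
      show ?thesis
      proof (cases "fst (last w) = i")
        case True
        obtain P0 k0 s0 where 0: "ssyt P0" "ins (snd (last w)) P0 P k0 s0"
          "\<forall>R \<in> set Q. \<forall>x \<in> set (drop (Suc s0) R). x < fst (last w)"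
          using inv(6) w(2) by blast
        have "snd (last w) \<le> j" using lex True w(2) by (simp add: lex_ordered_snoc)
        then have "s0 < s" using ins_ins_le[OF 0(2) P'(2) 0(1)] by blast
        then have "y \<in> set (drop (Suc s0) R)"
          using that(2) set_drop_subset_set_drop[of "Suc s0" s R] by auto
        then show ?thesis using 0(3) that(1) True by blast
      next
        case False
        then show ?thesis using w last by fastforce
      qed
    qed
    moreover have "\<forall>R \<in> set Q. \<forall>y \<in> set R. y \<le> i" using le last by (meson le_trans)
    ultimately have "grows i k Q" 
      using P'(2) inv by (intro grows_ins[OF P'(2) inv(1-3)]) auto
    then show ?thesis
      using P' R ins_row_len[OF P'(2)] row_len_cong[OF inv(3)]
      by (auto simp: RSK_snoc rsk_step_def)
  qed
  have inv: "ssyt P \<and> ssyt Q \<and> map length P = map length Q \<and>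
    \<Union> (set ` set P) = snd ` set w \<and> \<Union> (set ` set Q) = fst ` set w \<and>
    (w \<noteq> [] \<longrightarrow> (\<exists>P0 k s. ssyt P0 \<and> ins (snd (last w)) P0 P k s \<and>
      (\<exists>R \<in> set Q. fst (last w) \<in> set (drop s R)) \<and>
      (\<forall>R \<in> set Q. \<forall>x \<in> set (drop (Suc s) R). x < fst (last w))))"
    if "lex_ordered w" "RSK w = (P, Q)" for w P Q
    using that
  proof (induction w arbitrary: P Q rule: rev_induct)
    case (snoc b w)
    obtain i j where b: "b = (i, j)" by (cases b)
    obtain P0 Q0 where PQ0: "RSK w = (P0, Q0)" by (cases "RSK w")
    note IH = snoc.IH[OF _ PQ0]
    have lex: "lex_ordered w" using snoc.prems(1) by (simp add: lex_ordered_snoc)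
    have "\<exists>P' k s. ins j P0 P' k s \<and>
        RSK (w @ [(i, j)]) = (P', add_cell i k Q0) \<and> grows i k Q0 \<and> s = row_len Q0 k"
      by (rule step[OF snoc.prems(1)[unfolded b] PQ0]) (use IH[OF lex] in simp_all)
    then obtain P' k s where st: "ins j P0 P' k s" "RSK (w @ [(i, j)]) = (P', add_cell i k Q0)"
        "grows i k Q0" "s = row_len Q0 k"
      by blast
    then have PQ: "P = P'" "Q = add_cell i k Q0" using snoc.prems(2) b by auto
    have "map length P = map length Q"
      using ins_shape[OF st(1), of Q0 i] IH[OF lex] PQ by simp
    moreover have "ssyt P" "ssyt Q"
      using IH[OF lex] ssyt_ins[OF st(1)] ssyt_add_cell[OF st(3)] PQ by auto
    moreover have "\<Union> (set ` set P) = snd ` set (w @ [b])" "\<Union> (set ` set Q) = fst ` set (w @ [b])"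
      using IH[OF lex] ins_set[OF st(1)] set_add_cell[OF st(3)] PQ b by auto
    moreover have "\<exists>P0 k s. ssyt P0 \<and> ins (snd (last (w @ [b]))) P0 P k s \<and>
      (\<exists>R \<in> set Q. fst (last (w @ [b])) \<in> set (drop s R)) \<and>
      (\<forall>R \<in> set Q. \<forall>x \<in> set (drop (Suc s) R). x < fst (last (w @ [b])))"
      using IH[OF lex] st(1) add_cell_new_cell[OF st(3)] b
      by (intro exI[of _ P0] exI[of _ k] exI[of _ s]) (simp add: PQ st(4)[symmetric])
    ultimately show ?case by blast
  qed simp
  show "ssyt P \<and> ssyt Q \<and> map length P = map length Q \<and>
    \<Union> (set ` set P) = snd ` set w \<and> \<Union> (set ` set Q) = fst ` set w \<and>
    (w \<noteq> [] \<longrightarrow> (\<exists>P0 k s. ssyt P0 \<and> ins (snd (last w)) P0 P k s \<and>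
      (\<exists>R \<in> set Q. fst (last w) \<in> set (drop s R)) \<and>
      (\<forall>R \<in> set Q. \<forall>x \<in> set (drop (Suc s) R). x < fst (last w))))"
    using inv assms .
  show "lex_ordered (w @ [(i, j)]) \<Longrightarrow> \<exists>P' k s. ins j P P' k s \<and>
      RSK (w @ [(i, j)]) = (P', add_cell i k Q) \<and> grows i k Q \<and> s = row_len Q k"
    by (erule step[OF _ assms(2)]) (use inv[OF assms] in simp_all)
qed

lemma
  assumes "lex_ordered w" "RSK w = (P, Q)"
  shows RSK_ssyt: "ssyt P" "ssyt Q"
    and RSK_shape: "map length P = map length Q"
    and RSK_content: "\<Union> (set ` set P) = snd ` set w" "\<Union> (set ` set Q) = fst ` set w"
  using RSK_invariants[OF assms] by simp_all

text \<open>The last cell is recovered as the rightmost one that holds the largest letter.\<close>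

lemma grows_add_cell_eq:
  assumes "grows i k T" "grows i' k' T'" "add_cell i k T = add_cell i' k' T'"
  shows "i = i' \<and> k = k' \<and> T = T'"
proof -
  have "\<And>i k T i' k' T'. grows i k T \<Longrightarrow> grows i' k' T' \<Longrightarrow> add_cell i k T = add_cell i' k' T' \<Longrightarrow> i \<le> i'"
    by (metis add_cell_new_cell(1) grows_le in_set_dropD)
  then have i: "i = i'" using assms by (metis antisym)
  \<comment> \<open>If the rows differ, the cell added to \<open>T'\<close> already belongs to
    \<open>T\<close>, hence lies left of the cell added to \<open>T\<close>; by symmetry this is
    contradictory.\<close>
  have less: "row_len T' k' < row_len T k"
    if gr: "grows i k T" "grows i k' T'" "add_cell i k T = add_cell i k' T'" "k \<noteq> k'" for k k' T T'
  proof (rule ccontr)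
    assume not_less: "\<not> ?thesis"
    obtain S R U where 1: "length S = k" "add_cell i k T = S @ (R @ [i]) # U" "row_len T k = length R"
      "T = (if R = [] then S else S @ R # U)" "R = [] \<longrightarrow> U = []"
      using gr(1) by (rule grows_split)
    obtain S' R' U' where 2: "length S' = k'" "add_cell i k' T' = S' @ (R' @ [i]) # U'"
      "row_len T' k' = length R'" using gr(2) by (rule grows_split)
    have eq: "S @ (R @ [i]) # U = S' @ (R' @ [i]) # U'" using gr(3) 1 2 by simp
    then obtain E where "S = S' @ E \<and> E @ (R @ [i]) # U = (R' @ [i]) # U' \<or>
        S @ E = S' \<and> (R @ [i]) # U = E @ (R' @ [i]) # U'"
      using append_eq_append_conv2[THEN iffD1, OF eq] by blast
    then have "R' @ [i] \<in> set S \<union> set U"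
      using 1(1) 2(1) \<open>k \<noteq> k'\<close> by (cases E) auto
    then have "R' @ [i] \<in> set T" using 1(4,5) by auto
    moreover have "i \<in> set (drop (length R) (R' @ [i]))"
      using not_less 1(3) 2(3) by simp
    ultimately show False using gr(1) unfolding grows_def 1(3) by blast
  qed
  have k: "k = k'"
    using less[of k T k' T'] less[of k' T' k T] assms i by force
  obtain S R U where 1: "length S = k" "add_cell i k T = S @ (R @ [i]) # U"
      "T = (if R = [] then S else S @ R # U)"
    using assms(1) by (rule grows_split)
  obtain S' R' U' where 2: "length S' = k'" "add_cell i' k' T' = S' @ (R' @ [i']) # U'"
      "T' = (if R' = [] then S' else S' @ R' # U')"
    using assms(2) by (rule grows_split)
  have "S = S' \<and> R = R' \<and> U = U'"
    using 1(1,2) 2(1,2) assms(3) k by simp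
  then show ?thesis using i k 1(3) 2(3) by simp
qed

lemma RSK_inj: "lex_ordered w \<Longrightarrow> lex_ordered w' \<Longrightarrow> RSK w = RSK w' \<Longrightarrow> w = w'"
proof (induction w arbitrary: w' rule: rev_induct)
  case Nil
  have "set w' = {}"
    using RSK_content[OF Nil(2), of "[]" "[]"] Nil(3) by simp
  then show ?case by simp
next
  case (snoc b w)
  obtain i j where b: "b = (i, j)" by (cases b)
  obtain P Q where PQ: "RSK (w @ [b]) = (P, Q)" by (cases "RSK (w @ [b])")
  have "w' \<noteq> []"
  proof
    assume "w' = []"
    then have "RSK (w @ [b]) = ([], [])" using snoc.prems(3) by simp
    then show False using RSK_content[OF snoc.prems(1)] by force
  qed
  then obtain v i' j' where w': "w' = v @ [(i', j')]" by (metis prod.exhaust rev_exhaust)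
  obtain P1 Q1 where 1: "RSK w = (P1, Q1)" by (cases "RSK w")
  obtain P2 Q2 where 2: "RSK v = (P2, Q2)" by (cases "RSK v")
  have lex: "lex_ordered w" "lex_ordered v" using snoc.prems w' by (auto simp: lex_ordered_snoc)
  obtain k s where s1: "ins j P1 P k s" "Q = add_cell i k Q1" "grows i k Q1"
    using RSK_snoc_invariants[OF lex(1) 1, of i j] snoc.prems(1) b PQ by auto
  obtain k' s' where s2: "ins j' P2 P k' s'" "Q = add_cell i' k' Q2" "grows i' k' Q2"
    using RSK_snoc_invariants[OF lex(2) 2, of i' j'] snoc.prems(2,3) w' PQ by auto
  have eq: "i = i'" "k = k'" "Q1 = Q2" using grows_add_cell_eq s1 s2 by metis+
  then have "j = j' \<and> P1 = P2"
    using ins_unique s1(1) s2(1) RSK_ssyt(1)[OF lex(1) 1] RSK_ssyt(1)[OF lex(2) 2] by metis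
  then show ?case using snoc.IH[OF lex] 1 2 eq b w' by simp
qed

lemma map_length_add_cell:
  "map length (add_cell i k T) =
    (if k < length T then (map length T)[k := Suc (row_len T k)] else map length T @ [1])"
  by (auto simp: add_cell_def map_update row_len_def)

text \<open>The last cell of \<open>Q\<close> tells from which corner of \<open>P\<close> to insert
  backwards; \<open>ins_ins_gt\<close> ensures that the resulting biword is ordered.\<close>

lemma RSK_surj:
  assumes "ssyt Q" "ssyt P" "map length P = map length Q"
  shows "\<exists>w. lex_ordered w \<and> RSK w = (P, Q)"
  using assms
proof (induction arbitrary: P rule: ssyt_induct)
  case Nil
  then show ?case by (intro exI[of _ "[]"]) simp
next
  case (add_cell i k Q)
  obtain S R U where split: "length S = k" "add_cell i k Q = S @ (R @ [i]) # U"
    "row_len Q k = length R" "\<forall>X \<in> set U. above R X" "ssyt Q"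
    using add_cell.hyps unfolding grows_def by (metis grows_split[OF add_cell.hyps])
  have mP: "map length P = map length S @ Suc (length R) # map length U"
    using add_cell.prems(2) split(2) by simp
  have k: "k < length P" using split(1) arg_cong[OF mP, of length] by simp
  have Pk: "length (P ! k) = Suc (length R)"
    using arg_cong[OF mP, of "\<lambda>l. l ! k"] k split(1) by (simp add: nth_append)
  have "map length (drop (Suc k) P) = map length U"
    using arg_cong[OF mP, of "drop (Suc k)"] split(1) by (simp add: drop_map)
  then have "length ` set (drop (Suc k) P) = length ` set U" by (metis list.set_map)
  moreover have "\<forall>X \<in> set U. length X < Suc (length R)" using split(4) by (auto simp: above_def)
  ultimately have "\<forall>X \<in> set (drop (Suc k) P). length X < length (P ! k)"
    unfolding Pk by (metis (no_types, lifting) imageE imageI)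
  then obtain x P0 where P0: "ssyt P0" "ins x P0 P k (length R)"
    using ins_exists[OF add_cell.prems(1) k] Pk by auto
  have rl: "row_len P0 k = length R" using ins_row_len[OF P0(2)] by simp
  have shape: "map length (add_cell i k P0) = map length (add_cell i k Q)"
    using ins_shape[OF P0(2), of P0 i] add_cell.prems(2) by simp
  \<comment> \<open>Rows of a tableau are nonempty, so \<open>row_len\<close> shows whether removing
    the cell deletes its row.\<close>
  have iff: "k < length T \<longleftrightarrow> 0 < row_len T k" if "ssyt T" for T
    using that by (auto simp: row_len_def ssyt_iff) (metis nth_mem)
  have lt: "k < length P0 \<longleftrightarrow> k < length Q" using iff P0(1) split(5) rl split(3) by simp
  have "map length P0 = map length Q"
  proof (cases "k < length Q")
    case True
    let ?p = "map length P0" and ?q = "map length Q"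
    have "?p[k := Suc (length R)] = ?q[k := Suc (length R)]"
      using shape True lt rl split(3) by (simp add: map_length_add_cell)
    then have "?p[k := length R] = ?q[k := length R]" by (metis list_update_overwrite)
    moreover have "?p ! k = length R" "?q ! k = length R"
      using True lt rl split(3) by (auto simp: row_len_def)
    ultimately show ?thesis by (metis list_update_id)
  next
    case False
    then show ?thesis using shape lt by (simp add: map_length_add_cell)
  qed
  then obtain w where w: "lex_ordered w" "RSK w = (P0, Q)"
    using add_cell.IH P0(1) by blast
  note inv = RSK_invariants[OF w, THEN conjunct2, THEN conjunct2, THEN conjunct2, THEN conjunct2,
      THEN conjunct2, THEN mp]
  have "fst (last w) \<le> i \<and> (fst (last w) = i \<longrightarrow> snd (last w) \<le> x)" if w0: "w \<noteq> []"
  proof -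
    obtain P1 k1 s1 where 1: "ssyt P1" "ins (snd (last w)) P1 P0 k1 s1"
        "\<exists>X \<in> set Q. fst (last w) \<in> set (drop s1 X)"
      using inv[OF w0] by blast
    then obtain X where X: "X \<in> set Q" "fst (last w) \<in> set (drop s1 X)" by blast
    then have le: "fst (last w) \<le> i"
      using add_cell.hyps in_set_dropD[OF X(2)] by (auto simp: grows_def)
    \<comment> \<open>A smaller \<open>x\<close> would put the new cell weakly left of an earlier
      copy of \<open>i\<close>, which \<open>grows\<close> excludes.\<close>
    have "snd (last w) \<le> x" if "fst (last w) = i"
    proof (rule ccontr)
      assume "\<not> snd (last w) \<le> x"
      then have len: "length R \<le> s1" using ins_ins_gt[OF 1(2) P0(2) 1(1)] by simp
      have "i \<in> set (drop (length R) X)"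
        using X(2) that set_drop_subset_set_drop[OF len, of X] by auto
      then show False using add_cell.hyps X(1) unfolding grows_def split(3) by blast
    qed
    then show ?thesis using le by blast
  qed
  then have "lex_ordered (w @ [(i, x)])" using w(1) by (simp add: lex_ordered_snoc)
  moreover have "RSK (w @ [(i, x)]) = (P, add_cell i k Q)"
    using w(2) ins_row_insert[OF P0(2)] by (simp add: RSK_snoc rsk_step_def)
  ultimately show ?case by blast
qed

text \<open>With both thresholds fixed, the induction compares the inequalities before and after the
  last biletter; \<open>col_len Q\<close> gives the column lengths of both tableaux.\<close>

lemma RSK_corner_empty:
  assumes "lex_ordered w" "RSK w = (P, Q)"
  shows "(\<forall>r. decr_len b P r + decr_len a Q r \<le> col_len Q r) \<longleftrightarrow>
    (\<forall>(i, j) \<in> set w. i \<le> a \<or> j \<le> b)"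
  using assms
proof (induction w arbitrary: P Q rule: rev_induct)
  case Nil
  then have "P = []" "Q = []" by auto
  then show ?case using decr_len_eq_0[of "[]"] by simp
next
  case (snoc p w)
  obtain i j where p: "p = (i, j)" by (cases p)
  obtain P0 Q0 where PQ0: "RSK w = (P0, Q0)" by (cases "RSK w")
  have lex: "lex_ordered w" using snoc.prems(1) by (simp add: lex_ordered_snoc)
  obtain k s where ins: "ins j P0 P k s" and Q: "Q = add_cell i k Q0" and gr: "grows i k Q0"
      and s: "s = row_len Q0 k"
    using RSK_snoc_invariants[OF lex PQ0, of i j] snoc.prems p by auto
  have P0: "ssyt P0" and shape: "\<And>r. col_len P0 r = col_len Q0 r"
    by (rule RSK_ssyt[OF lex PQ0], rule col_len_cong[OF RSK_shape[OF lex PQ0]])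
  have P: "ssyt P" and shape': "\<And>r. col_len P r = col_len Q r"
    by (rule RSK_ssyt[OF snoc.prems], rule col_len_cong[OF RSK_shape[OF snoc.prems]])
  have cl: "col_len Q r = col_len Q0 r + (if r = s then 1 else 0)" for r
    unfolding Q s by (rule col_len_add_cell[OF gr])
  note IH = snoc.IH[OF lex PQ0]
  consider "\<not> a < i" | "a < i" "b < j" | "a < i" "j \<le> b" by linarith
  then show ?case
  proof cases
    case 1
    \<comment> \<open>Both sides are true, as no top letter exceeds \<open>a\<close>.\<close>
    have "decr_len a Q r = 0" for r
      unfolding Q by (rule decr_len_add_cell_eq_0[OF gr 1])
    then have "\<forall>r. decr_len b P r + decr_len a Q r \<le> col_len Q r"
      using decr_len_le_col_len[OF P] shape' by simp
    moreover have "i' \<le> a" if "(i', j') \<in> set (w @ [p])" for i' j'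
      using lex_ordered_fst_le[OF snoc.prems(1) that] 1 p by simp
    ultimately show ?thesis by blast
  next
    case 2
    \<comment> \<open>Both sides are false; the bumping path breaks the inequality at column
      \<open>s\<close>.\<close>
    have "col_len Q0 s < decr_len b P s" using decr_len_ins_large[OF ins P0 2(2)] shape by simp
    moreover have "decr_len a Q s = Suc (decr_len a Q0 s)"
      unfolding Q using decr_len_add_cell[OF gr 2(1) s] by simp
    ultimately have "\<not> decr_len b P s + decr_len a Q s \<le> col_len Q s" using cl[of s] by simp
    moreover have "\<not> (\<forall>(i, j) \<in> set (w @ [p]). i \<le> a \<or> j \<le> b)" using 2 p by auto
    ultimately show ?thesis by blast
  next
    case 3
    have dQ: "decr_len a Q r =
        decr_len a Q0 r + (if r \<le> s \<and> decr_len a Q0 r = decr_len a Q0 s then 1 else 0)" for r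
      unfolding Q by (rule decr_len_add_cell[OF gr 3(1) s])
    have dP: "r \<le> s \<Longrightarrow> decr_len b P r = decr_len b P0 r" for r
      by (rule decr_len_ins_left[OF ins P0 3(2)])
    have "(\<forall>r. decr_len b P r + decr_len a Q r \<le> col_len Q r) \<longleftrightarrow>
        (\<forall>r. decr_len b P0 r + decr_len a Q0 r \<le> col_len Q0 r)"
    proof (intro iffI allI)
      fix r assume A: "\<forall>r. decr_len b P0 r + decr_len a Q0 r \<le> col_len Q0 r"
      consider "s < r" | "r = s" | "r < s" by linarith
      then show "decr_len b P r + decr_len a Q r \<le> col_len Q r"
      proof cases
        case 1
        then show ?thesis
          using A[rule_format, of r] decr_len_ins_le[OF ins P0 3(2), of r] dQ[of r] cl[of r] by simp
      next
        case 2
        then show ?thesis using A[rule_format, of r] dP[of r] dQ[of r] cl[of r] by simp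
      next
        case r: 3
        \<comment> \<open>Growth at \<open>r\<close> needs equal old values of
          \<open>decr_len a Q0\<close> at \<open>r\<close> and \<open>s\<close>. The bound at
          \<open>s\<close>, where the column gained a cell, then passes to \<open>r\<close>.\<close>
        have "decr_len b P r + col_len P s \<le> decr_len b P s + col_len P r"
          using r by (intro decr_len_complement_antimono[OF P]) simp
        then show ?thesis
          using A[rule_format, of r] A[rule_format, of s] r dP[of r] dP[of s] dQ[of r] cl[of r] cl[of s]
            shape' by (simp split: if_splits)
      qed
    next
      fix r assume A: "\<forall>r. decr_len b P r + decr_len a Q r \<le> col_len Q r"
      show "decr_len b P0 r + decr_len a Q0 r \<le> col_len Q0 r"
      proof (cases "r \<le> s")
        case True
        then show ?thesis
          using A[rule_format, of r] dP[of r] dQ[of r] cl[of r] by (simp split: if_splits)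
      next
        case False
        then have "s < r" by simp
        from decr_len_ins_right[OF ins P0 3(2) this] show ?thesis
        proof
          assume "decr_len b P r = decr_len b P0 r"
          then show ?thesis using A[rule_format, of r] dQ[of r] cl[of r] False by simp
        next
          assume "decr_len b P0 r + col_len P0 s \<le> decr_len b P0 s + col_len P0 r"
          \<comment> \<open>At \<open>s\<close> the column and the value for \<open>Q\<close> both
            grew by one; the old bound there carries over to \<open>r\<close>.\<close>
          moreover have "decr_len a Q0 r \<le> decr_len a Q0 s"
            using \<open>s < r\<close> by (intro decr_len_antimono) simp
          ultimately show ?thesis
            using A[rule_format, of s] dP[of s] dQ[of s] cl[of s] shape by simp
        qed
      qed
    qed
    also have "\<dots> \<longleftrightarrow> (\<forall>(i, j) \<in> set w. i \<le> a \<or> j \<le> b)" by (rule IH)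
    also have "\<dots> \<longleftrightarrow> (\<forall>(i, j) \<in> set (w @ [p]). i \<le> a \<or> j \<le> b)" using 3 p by auto
    finally show ?thesis .
  qed
qed


subsection \<open>The columns of the right key\<close>

definition key_col :: "nat filling \<Rightarrow> nat \<Rightarrow> nat list" where
  "key_col T r = rev (sup_words (decr_subwords (map (drop r) T)))"

definition entries :: "nat filling \<Rightarrow> nat set" where
  "entries T = \<Union> (set ` set T)"

text \<open>For positive letters the threshold 0 is vacuous.\<close>

lemma decr_subwords_eq:
  assumes "0 \<notin> entries T"
  shows "decr_subwords (map (drop r) T) = {u. decr_sub 0 (col_word r T) u}"
proof -
  have "0 < x" if "subseq u (col_word r T)" "x \<in> set u" for u x
  proof -
    have "x \<in> set (col_word r T)" using that by (auto elim: list_emb_set)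
    then have "x \<in> entries T" by (auto simp: set_col_word entries_def dest: in_set_dropD)
    then show ?thesis using assms by (cases x) auto
  qed
  then show ?thesis by (auto simp: decr_subwords_def decr_sub_def col_word_def)
qed

lemma length_sup_words: "length (sup_words {u. decr_sub 0 w u}) = longest_decr 0 w"
  by (simp add: sup_words_def longest_decr_def)

lemma sup_words_nth:
  assumes "i < longest_decr 0 w"
  shows "\<exists>u. decr_sub 0 w u \<and> i < length u \<and> sup_words {u. decr_sub 0 w u} ! i = u ! i \<and>
    (\<forall>v. decr_sub 0 w v \<and> i < length v \<longrightarrow> v ! i \<le> u ! i)"
proof -
  let ?S = "(\<lambda>u. u ! i) ` {u \<in> {u. decr_sub 0 w u}. i < length u}"
  have fin: "finite ?S" using finite_decr_sub[of 0 w] by simp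
  obtain v where "decr_sub 0 w v" "length v = longest_decr 0 w" by (rule longest_decr_attained)
  then have "?S \<noteq> {}" using assms by auto
  then have "Max ?S \<in> ?S" by (rule Max_in[OF fin])
  then obtain u where u: "decr_sub 0 w u" "i < length u" "Max ?S = u ! i" by auto
  moreover have "sup_words {u. decr_sub 0 w u} ! i = Max ?S"
    using assms by (simp add: sup_words_def longest_decr_def)
  moreover have "v ! i \<le> u ! i" if "decr_sub 0 w v" "i < length v" for v
    unfolding u(3)[symmetric] by (rule Max_ge[OF fin]) (use that in auto)
  ultimately show ?thesis by auto
qed

lemma sorted_sup_words: "sorted_wrt (>) (sup_words {u. decr_sub 0 w u})"
  unfolding sorted_wrt_iff_nth_less length_sup_words
proof (intro allI impI)
  fix i j assume ij: "i < j" "j < longest_decr 0 w"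
  obtain u where u: "decr_sub 0 w u" "j < length u" "sup_words {u. decr_sub 0 w u} ! j = u ! j"
    using sup_words_nth[OF ij(2)] by blast
  obtain v where "decr_sub 0 w v" "i < length v" and v: "sup_words {u. decr_sub 0 w u} ! i = v ! i"
    "\<And>u. decr_sub 0 w u \<Longrightarrow> i < length u \<Longrightarrow> u ! i \<le> v ! i"
    using sup_words_nth[OF less_trans[OF ij]] by blast
  have "u ! j < u ! i" using u(1,2) ij(1) by (simp add: decr_sub_def sorted_wrt_iff_nth_less)
  also have "\<dots> \<le> v ! i" using u ij(1) by (intro v(2)) auto
  finally show "sup_words {u. decr_sub 0 w u} ! i > sup_words {u. decr_sub 0 w u} ! j"
    by (simp add: u v)
qed

text \<open>If the letter at \<open>i\<close> of a decreasing word exceeds \<open>b\<close>, so do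
  all letters before it. Hence the supremum has exactly \<open>longest_decr b w\<close> letters
  above \<open>b\<close>.\<close>

lemma sup_words_gt_iff:
  assumes "i < longest_decr 0 w"
  shows "b < sup_words {u. decr_sub 0 w u} ! i \<longleftrightarrow> i < longest_decr b w"
proof -
  obtain u where u: "decr_sub 0 w u" "i < length u" "sup_words {u. decr_sub 0 w u} ! i = u ! i"
    "\<And>v. decr_sub 0 w v \<Longrightarrow> i < length v \<Longrightarrow> v ! i \<le> u ! i"
    using sup_words_nth[OF assms] by blast
  have "i < longest_decr b w" if "b < u ! i"
  proof -
    have "b < x" if x: "x \<in> set (take (Suc i) u)" for x
    proof -
      obtain p where p: "p \<le> i" "u ! p = x" using x u(2) by (auto simp: in_set_conv_nth less_Suc_eq_le)
      have "u ! i \<le> u ! p" using u(1,2) p(1)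
        by (cases "p = i") (auto simp: decr_sub_def sorted_wrt_iff_nth_less intro: less_imp_le)
      then show ?thesis using \<open>b < u ! i\<close> p(2) by simp
    qed
    moreover have "subseq (take (Suc i) u) w" "sorted_wrt (>) (take (Suc i) u)"
      using u(1) unfolding decr_sub_def
      by (auto intro: subseq_order.order_trans[OF prefix_imp_subseq[OF take_is_prefix]]
          simp: sorted_wrt_take)
    ultimately have "decr_sub b w (take (Suc i) u)" by (auto simp: decr_sub_def)
    from decr_sub_length_le[OF this] show ?thesis using u(2) by simp
  qed
  moreover have "b < u ! i" if "i < longest_decr b w"
  proof -
    obtain v where v: "decr_sub b w v" "length v = longest_decr b w" by (rule longest_decr_attained)
    have "b < v ! i" using v that by (auto simp: decr_sub_def)
    moreover have "decr_sub 0 w v" using v(1) by (auto simp: decr_sub_def)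
    then have "v ! i \<le> u ! i" using v(2) that by (intro u(4)) auto
    ultimately show ?thesis by simp
  qed
  ultimately show ?thesis using u(3) by auto
qed

text \<open>In each growth step the value rises only in the column of the new cell, as the columns
  to its left are strictly longer.\<close>

lemma decr_len_0: "ssyt T \<Longrightarrow> 0 \<notin> entries T \<Longrightarrow> decr_len 0 T r = col_len T r"
proof (induction arbitrary: r rule: ssyt_induct)
  case Nil
  then show ?case using decr_len_eq_0[of "[]"] by simp
next
  case (add_cell i k T)
  have e: "entries (add_cell i k T) = insert i (entries T)"
    unfolding entries_def by (rule set_add_cell[OF add_cell.hyps])
  then have i: "0 < i" and T: "\<And>r. decr_len 0 T r = col_len T r"
    using add_cell by auto
  show ?case
    using col_len_row_len_less[OF add_cell.hyps, of r]
    by (auto simp: decr_len_add_cell[OF add_cell.hyps i refl] col_len_add_cell[OF add_cell.hyps] T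
        dest: le_neq_implies_less)
qed

lemma key_col_props:
  assumes "ssyt T" "0 \<notin> entries T"
  shows length_key_col: "length (key_col T r) = col_len T r"
    and sorted_key_col: "sorted_wrt (<) (key_col T r)"
    and filter_key_col: "length (filter (\<lambda>x. b < x) (key_col T r)) = decr_len b T r"
    and set_key_col: "set (key_col T r) \<subseteq> entries T"
proof -
  let ?w = "col_word r T"
  let ?s = "sup_words {u. decr_sub 0 ?w u}"
  have k: "key_col T r = rev ?s" unfolding key_col_def decr_subwords_eq[OF assms(2)] ..
  show "length (key_col T r) = col_len T r"
    using decr_len_0[OF assms] unfolding k by (simp add: length_sup_words decr_len_def)
  show "sorted_wrt (<) (key_col T r)"
    unfolding k sorted_wrt_rev using sorted_sup_words by simp
  have "length (filter (\<lambda>x. b < x) (key_col T r)) = length (filter (\<lambda>x. b < x) ?s)"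
    unfolding k by (simp flip: rev_filter)
  also have "\<dots> = card {i. i < longest_decr 0 ?w \<and> b < ?s ! i}"
    by (simp add: length_filter_conv_card length_sup_words)
  also have "{i. i < longest_decr 0 ?w \<and> b < ?s ! i} = {..<longest_decr b ?w}"
    using sup_words_gt_iff longest_decr_antimono[of 0 b ?w] by auto
  finally show "length (filter (\<lambda>x. b < x) (key_col T r)) = decr_len b T r"
    by (simp add: decr_len_def)
  show "set (key_col T r) \<subseteq> entries T"
  proof
    fix x assume "x \<in> set (key_col T r)"
    then obtain i where i: "i < longest_decr 0 ?w" "x = ?s ! i"
      unfolding k by (auto simp: in_set_conv_nth length_sup_words)
    obtain u where u: "decr_sub 0 ?w u" "i < length u" "?s ! i = u ! i"
      using sup_words_nth[OF i(1)] by blast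
    then have "x \<in> set ?w" using i(2) by (metis decr_sub_set nth_mem)
    then show "x \<in> entries T" by (auto simp: set_col_word entries_def dest: in_set_dropD)
  qed
qed

lemma filter_gt_pred:
  fixes x :: nat
  assumes "0 < x"
  shows "length (filter (\<lambda>y. x - 1 < y) A) = length (filter (\<lambda>y. x < y) A) + count_list A x"
  using assms by (induction A) auto

text \<open>Recovers the members of a key column from the counts in
  \<open>filter_key_col\<close>.\<close>

lemma mem_iff_filter_gt:
  fixes x :: nat
  assumes "0 < x"
  shows "x \<in> set A \<longleftrightarrow> length (filter (\<lambda>y. x < y) A) < length (filter (\<lambda>y. x - 1 < y) A)"
  unfolding filter_gt_pred[OF assms] by (metis count_list_0_iff less_add_same_cancel1 neq0_conv)

lemma key_col_nested:
  assumes "ssyt T" "0 \<notin> entries T" "r \<le> s"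
  shows "set (key_col T s) \<subseteq> set (key_col T r)"
proof
  fix x assume x: "x \<in> set (key_col T s)"
  then have "0 < x" using set_key_col[OF assms(1,2)] assms(2) by (metis gr0I subsetD)
  note mem = mem_iff_filter_gt[OF this] filter_key_col[OF assms(1,2)]
  have "decr_len x T s < decr_len (x - 1) T s" using x by (simp add: mem)
  moreover have "decr_len x T r + decr_len (x - 1) T s \<le> decr_len (x - 1) T r + decr_len x T s"
    by (rule decr_len_differences[OF assms(1) _ assms(3)]) simp
  ultimately show "x \<in> set (key_col T r)" by (simp add: mem)
qed

lemma col_len_pos_iff: "0 < col_len T r \<longleftrightarrow> r < length (transpose T)"
  by (auto simp: col_len_def length_transpose_gt_iff filter_empty_conv)

lemma right_key_eq: "right_key T = transpose (map (key_col T) [0..<length (transpose T)])"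
  by (auto simp: right_key_def key_col_def intro!: arg_cong[of _ _ transpose])

text \<open>On nonempty columns of weakly decreasing length \<open>transpose\<close> is an
  involution; key columns inherit their lengths from the tableau.\<close>

lemma transpose_transpose_columns:
  assumes "\<And>r. r < m \<Longrightarrow> length (f r) = col_len T r" "m = length (transpose T)"
  shows "transpose (transpose (map f [0..<m])) = map f [0..<m]"
proof -
  have "sorted (rev (map length (map f [0..<m])))"
    unfolding sorted_rev_iff_nth_mono using assms(1) by (simp add: col_len_antimono)
  moreover have "f r \<noteq> []" if "r < m" for r
    using assms that col_len_pos_iff[of T r] by (metis length_greater_0_conv)
  then have "takeWhile (\<lambda>x. x \<noteq> []) (map f [0..<m]) = map f [0..<m]"
    by (intro takeWhile_eq_all_conv[THEN iffD2]) auto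
  ultimately show ?thesis by (simp add: transpose_transpose)
qed

subsection \<open>The weak composition of a right key\<close>

text \<open>The counts are the parts of the conjugate partition, which determines the
  partition.\<close>

lemma decreasing_list_eqI:
  fixes xs ys :: "nat list"
  assumes "sorted (rev xs)" "sorted (rev ys)" "0 \<notin> set xs" "0 \<notin> set ys"
    "\<And>r. length (filter (\<lambda>x. r < x) xs) = length (filter (\<lambda>x. r < x) ys)"
  shows "xs = ys"
proof -
  have "mset xs = mset ys"
  proof (rule multiset_eqI)
    fix x
    show "count (mset xs) x = count (mset ys) x"
    proof (cases "0 < x")
      case True
      then show ?thesis
        using filter_gt_pred[OF True, of xs] filter_gt_pred[OF True, of ys] assms(5)[of x] assms(5)[of "x - 1"]
        by (simp add: count_mset)
    next
      case False
      then have "count (mset xs) x = 0" "count (mset ys) x = 0"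
        using assms(3,4) by simp_all
      then show ?thesis by (rule trans[OF _ sym])
    qed
  qed
  then have "mset (rev xs) = mset (rev ys)" by simp
  then have "rev xs = rev ys" using assms(1,2) by (metis properties_for_sort)
  then show ?thesis by simp
qed

lemma card_initial_ge:
  assumes "\<And>r s. r \<le> s \<Longrightarrow> s < m \<Longrightarrow> P s \<Longrightarrow> P r"
  shows "Suc r \<le> card {s. s < m \<and> P s} \<longleftrightarrow> r < m \<and> P r"
proof
  assume L: "Suc r \<le> card {s. s < m \<and> P s}"
  show "r < m \<and> P r"
  proof (rule ccontr)
    assume "\<not> (r < m \<and> P r)"
    then have "{s. s < m \<and> P s} \<subseteq> {..<r}"
      using assms[of r] by (auto simp: not_le[symmetric]) (meson le_less_trans not_le)
    from card_mono[OF _ this] L show False by simp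
  qed
next
  assume "r < m \<and> P r"
  then have "{..r} \<subseteq> {s. s < m \<and> P s}" using assms by auto
  from card_mono[OF _ this] show "Suc r \<le> card {s. s < m \<and> P s}" by simp
qed

text \<open>The part of \<alpha> at \<open>i\<close> is the number of key columns containing
  \<open>i\<close>; as the columns are nested, \<open>i\<close> lies in column \<open>r\<close> iff
  \<open>r\<close> is less than this number.\<close>

lemma right_key_is_key:
  assumes "ssyt Q" "entries Q \<subseteq> {1..n}"
  obtains \<alpha> where "length \<alpha> = n" "right_key Q = key \<alpha>"
    "map length Q = filter (\<lambda>k. k \<noteq> 0) (decr_rearr \<alpha>)"
proof -
  define m where "m = length (transpose Q)"
  define f where "f i = card {r. r < m \<and> i \<in> set (key_col Q r)}" for i
  define \<alpha> where "\<alpha> = map f [1..<Suc n]"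
  have pos: "0 \<notin> entries Q" using assms(2) by auto
  note kc = key_col_props[OF assms(1) pos]
  have f_ge: "Suc r \<le> f i \<longleftrightarrow> r < m \<and> i \<in> set (key_col Q r)" for i r
    unfolding f_def by (rule card_initial_ge) (use key_col_nested[OF assms(1) pos] in blast)
  have part: "part \<alpha> i = f i" if "i \<in> {1..n}" for i
    using that by (auto simp: Defs.part_def \<alpha>_def simp del: upt_Suc)
  have set_eq: "{i \<in> {1..n}. Suc r \<le> f i} = (if r < m then set (key_col Q r) else {})" for r
    using f_ge kc(4)[of r] assms(2) by auto
  have len: "length \<alpha> = n" by (simp add: \<alpha>_def)
  have fm: "f i \<le> m" for i
    using f_ge[of m i] by simp
  \<comment> \<open>Any letter of the last key column lies in all \<open>m\<close> columns.\<close>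
  have Max: "Max (insert 0 (set \<alpha>)) = m"
  proof (rule Max_eqI)
    show "y \<le> m" if "y \<in> insert 0 (set \<alpha>)" for y using that fm by (auto simp: \<alpha>_def)
    show "m \<in> insert 0 (set \<alpha>)"
    proof (cases m)
      case (Suc l)
      then have "0 < length (key_col Q l)" using col_len_pos_iff[of Q l] m_def kc(1)[of l] by simp
      then obtain i where i: "i \<in> set (key_col Q l)" by (metis length_pos_if_in_set nth_mem)
      then have "i \<in> {1..n}" using kc(4) assms(2) by blast
      moreover have "f i = m" using f_ge[of l i] i Suc fm[of i] by simp
      ultimately have "m \<in> set \<alpha>" unfolding \<alpha>_def by (auto simp del: upt_Suc)
      then show ?thesis by simp
    qed simp
  qed simp
  have "{i \<in> {1..length \<alpha>}. part \<alpha> i \<ge> Suc r} = {i \<in> {1..n}. Suc r \<le> f i}" for r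
    using part len by auto
  then have "sorted_list_of_set {i \<in> {1..length \<alpha>}. part \<alpha> i \<ge> Suc r} = key_col Q r" if "r < m" for r
    using that kc(2)[of r] set_eq[of r]
    by (simp add: sorted_list_of_set.idem_if_sorted_distinct strict_sorted_iff)
  \<comment> \<open>\<open>key\<close> counts columns from 1, hence the shift by
    \<open>Suc\<close>.\<close>
  then have key: "key \<alpha> = right_key Q"
    unfolding key_def right_key_eq Max map_Suc_upt[symmetric] One_nat_def m_def[symmetric]
    by (auto simp: comp_def simp del: upt_Suc intro!: arg_cong[of _ _ transpose])
  have "filter (\<lambda>k. k \<noteq> 0) (decr_rearr \<alpha>) = map length Q"
  proof (rule decreasing_list_eqI)
    show "sorted (rev (filter (\<lambda>k. k \<noteq> 0) (decr_rearr \<alpha>)))"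
      by (simp add: decr_rearr_def rev_filter sorted_wrt_filter)
    show "sorted (rev (map length Q))"
      using assms(1) unfolding ssyt_def sorted_wrt_rev by simp
    show "0 \<notin> set (filter (\<lambda>k. k \<noteq> 0) (decr_rearr \<alpha>))" by simp
    show "0 \<notin> set (map length Q)" using assms(1) by (auto simp: ssyt_iff)
    fix r
    have "length (filter (\<lambda>x. r < x) (filter (\<lambda>k. k \<noteq> 0) (decr_rearr \<alpha>))) =
        length (filter (\<lambda>x. r < x) (decr_rearr \<alpha>))"
      by (auto simp: filter_filter intro!: arg_cong[of _ _ length] filter_cong)
    also have "\<dots> = length (filter (\<lambda>x. r < x) \<alpha>)"
    proof -
      have "mset (decr_rearr \<alpha>) = mset \<alpha>" by (simp add: decr_rearr_def)
      then show ?thesis by (metis mset_filter size_mset)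
    qed
    also have "\<dots> = length (filter (\<lambda>i. r < f i) [1..<Suc n])"
      by (simp add: \<alpha>_def filter_map comp_def del: upt_Suc)
    also have "\<dots> = card {i \<in> {1..n}. Suc r \<le> f i}"
      by (subst distinct_card[symmetric])
        (auto simp del: upt_Suc intro!: arg_cong[of _ _ card])
    also have "\<dots> = col_len Q r"
    proof (cases "r < m")
      case True
      have "distinct (key_col Q r)" using kc(2) by (simp add: strict_sorted_iff)
      then show ?thesis using True kc(1) set_eq[of r] by (simp add: distinct_card)
    next
      case False
      then show ?thesis using set_eq[of r] col_len_pos_iff[of Q r] m_def by simp
    qed
    also have "\<dots> = length (filter (\<lambda>x. r < x) (map length Q))"
      by (simp add: col_len_def filter_map comp_def)
    finally show "length (filter (\<lambda>x. r < x) (filter (\<lambda>k. k \<noteq> 0) (decr_rearr \<alpha>))) =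
        length (filter (\<lambda>x. r < x) (map length Q))" .
  qed
  then show ?thesis using that len key by simp
qed

subsection \<open>Comparison of keys\<close>

text \<open>A pigeonhole argument: the entries of \<open>A\<close> above \<open>f a\<close> occupy
  the last positions, the entries of \<open>B\<close> that are at least \<open>a\<close> occupy the
  first ones after reversal, and the bounds say that these do not overlap.\<close>

lemma column_le_iff:
  fixes A B :: "nat list"
  assumes "sorted_wrt (<) A" "sorted_wrt (<) B" "length A = c" "length B = c" "set B \<subseteq> {1..n}"
    and anti: "\<And>x y. 1 \<le> x \<Longrightarrow> x \<le> y \<Longrightarrow> y \<le> n \<Longrightarrow> f y \<le> f x"
  shows "list_all2 (\<le>) A (map f (rev B)) \<longleftrightarrow>
    (\<forall>a \<in> {1..n}. length (filter (\<lambda>x. f a < x) A) + length (filter (\<lambda>y. a - 1 < y) B) \<le> c)"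
    (is "?L \<longleftrightarrow> ?R")
proof -
  have L: "?L \<longleftrightarrow> (\<forall>i < c. A ! i \<le> f (B ! (c - Suc i)))"
    using assms(3,4) by (auto simp: list_all2_conv_all_nth rev_nth)
  have B: "B ! i \<in> {1..n}" if "i < c" for i using assms(4,5) that nth_mem by blast
  show ?thesis
    unfolding L
  proof
    assume le: "\<forall>i < c. A ! i \<le> f (B ! (c - Suc i))"
    show ?R
    proof
      fix a assume a: "a \<in> {1..n}"
      let ?I = "{i. i < c \<and> f a < A ! i}" and ?J = "{j. j < c \<and> a - 1 < B ! j}"
      let ?J' = "(\<lambda>j. c - Suc j) ` ?J"
      have "inj_on (\<lambda>j. c - Suc j) ?J" by (auto simp: inj_on_def)
      then have J: "card ?J' = card ?J" by (rule card_image)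
      have "?I \<inter> ?J' = {}"
      proof (rule ccontr)
        assume "?I \<inter> ?J' \<noteq> {}"
        then obtain j where j: "j < c" "a - 1 < B ! j" "f a < A ! (c - Suc j)" by auto
        have "A ! (c - Suc j) \<le> f (B ! j)" using le[rule_format, of "c - Suc j"] j(1) by simp
        also have "\<dots> \<le> f a" using j a B[OF j(1)] by (intro anti) auto
        finally show False using j(3) by simp
      qed
      moreover have "?I \<union> ?J' \<subseteq> {..<c}" by auto
      ultimately have "card ?I + card ?J' \<le> c"
        using card_Un_disjoint[of ?I ?J'] card_mono[of "{..<c}" "?I \<union> ?J'"] by simp
      then show "length (filter (\<lambda>x. f a < x) A) + length (filter (\<lambda>y. a - 1 < y) B) \<le> c"
        using assms(3,4) J by (simp add: length_filter_conv_card)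
    qed
  next
    assume R: ?R
    show "\<forall>i < c. A ! i \<le> f (B ! (c - Suc i))"
    proof (intro allI impI, rule ccontr)
      fix i assume i: "i < c" "\<not> A ! i \<le> f (B ! (c - Suc i))"
      \<comment> \<open>A failure at \<open>i\<close> violates the bound for this \<open>a\<close>:
        at least \<open>c - i\<close> entries of \<open>A\<close> and \<open>i + 1\<close> entries
        of \<open>B\<close> are counted.\<close>
      let ?a = "B ! (c - Suc i)"
      have a: "?a \<in> {1..n}" using B i by simp
      have "A ! i \<le> A ! p" if "i \<le> p" "p < c" for p
        using assms(1,3) that by (cases "p = i") (auto simp: sorted_wrt_iff_nth_less intro: less_imp_le)
      then have "{i..<c} \<subseteq> {p. p < c \<and> f ?a < A ! p}" using i(2) by (fastforce simp: not_le)
      from card_mono[OF _ this] have 1: "c - i \<le> length (filter (\<lambda>x. f ?a < x) A)"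
        using assms(3) by (simp add: length_filter_conv_card)
      have "?a \<le> B ! p" if "c - Suc i \<le> p" "p < c" for p
        using assms(2,4) that by (cases "p = c - Suc i") (auto simp: sorted_wrt_iff_nth_less intro: less_imp_le)
      then have "{c - Suc i..<c} \<subseteq> {p. p < c \<and> ?a - 1 < B ! p}"
        using a by fastforce
      from card_mono[OF _ this] have "Suc i \<le> length (filter (\<lambda>y. ?a - 1 < y) B)"
        using assms(4) i(1) by (simp add: length_filter_conv_card)
      then show False using 1 R[rule_format, OF a] i(1) by simp
    qed
  qed
qed

lemma list_all2_column:
  "list_all2 (list_all2 P) A B \<Longrightarrow> list_all2 P
     (map (\<lambda>xs. xs ! i) (filter (\<lambda>xs. i < length xs) A))
     (map (\<lambda>xs. xs ! i) (filter (\<lambda>xs. i < length xs) B))"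
  by (induction rule: list_all2_induct) (auto dest: list_all2_lengthD list_all2_nthD)

lemma list_all2_transpose:
  assumes "list_all2 (list_all2 P) A B"
  shows "list_all2 (list_all2 P) (transpose A) (transpose B)"
proof -
  have "length (transpose A) = length (transpose B)"
    unfolding length_transpose using assms
    by (induction rule: list_all2_induct) (auto dest: list_all2_lengthD)
  then show ?thesis
    using list_all2_column[OF assms] by (simp add: list_all2_conv_all_nth[of "list_all2 P"] nth_transpose)
qed

lemma filling_le_transpose_iff:
  assumes "transpose (transpose A) = A" "transpose (transpose B) = B"
  shows "filling_le (transpose A) (transpose B) \<longleftrightarrow> list_all2 (list_all2 (\<le>)) A B"
  unfolding filling_le_def using list_all2_transpose assms by metis

text \<open>The next lower bound is smaller than \<open>k \<le> c\<close>, hence at most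
  \<open>c - 1\<close>, and survives the minimum.\<close>

lemma strictify_ge:
  assumes "list_all2 (\<le>) ks cs" "sorted_wrt (>) ks" shows "list_all2 (\<le>) ks (strictify cs)"
  using assms
proof (induction cs arbitrary: ks rule: strictify.induct)
  case (3 c c' cs)
  then obtain k k' ks' where "ks = k # k' # ks'" by (auto simp: list_all2_Cons2)
  then show ?case using 3 by auto
qed auto

lemma transpose_entries: "row \<in> set (transpose xs) \<Longrightarrow> x \<in> set row \<Longrightarrow> \<exists>col \<in> set xs. x \<in> set col"
  by (auto simp: in_set_conv_nth[of row "transpose xs"] nth_transpose) (metis nth_mem)

section \<open>Comparing the right keys of two tableaux of equal shape\<close>

context
  fixes lam :: "nat list" and P Q :: "nat filling" and \<alpha> :: "nat list"
  assumes lam: "sorted_wrt (\<ge>) lam"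
    and P: "ssyt P" "0 \<notin> entries P"
    and Q: "ssyt Q" "entries Q \<subseteq> {1..length lam}"
    and shape: "map length P = map length Q"
    and key: "right_key Q = key \<alpha>"
begin

private lemma Q_pos: "0 \<notin> entries Q"
  using Q(2) by auto

private lemma col_len_P: "col_len P r = col_len Q r"
  by (rule col_len_cong[OF shape])

private lemma columns_P: "length (transpose P) = length (transpose Q)"
  using col_len_pos_iff[of P] col_len_pos_iff[of Q] col_len_P
  by (metis linorder_neqE_nat less_irrefl)

private lemma key_columns:
  "transpose (right_key Q) = map (key_col Q) [0..<length (transpose Q)]"
  unfolding right_key_eq
  by (rule transpose_transpose_columns[OF length_key_col[OF Q(1) Q_pos] refl])

private lemma B_plus_eq:
  "B_plus lam \<alpha> = transpose (map (\<lambda>r. map (part lam) (rev (key_col Q r))) [0..<length (transpose Q)])"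
  unfolding B_plus_def key[symmetric] key_columns by (simp add: comp_def)

private lemma B_plus_columns:
  "transpose (B_plus lam \<alpha>) = map (\<lambda>r. map (part lam) (rev (key_col Q r))) [0..<length (transpose Q)]"
  unfolding B_plus_eq
  by (rule transpose_transpose_columns[OF _ refl]) (simp add: length_key_col[OF Q(1) Q_pos])

lemma part_antimono: "1 \<le> x \<Longrightarrow> x \<le> y \<Longrightarrow> y \<le> length lam \<Longrightarrow> part lam y \<le> part lam x"
  using lam by (cases "x = y") (auto simp: Defs.part_def sorted_wrt_iff_nth_less)

lemma right_key_le_iff_columns:
  "filling_le (right_key P) (B_plus lam \<alpha>) \<longleftrightarrow> (\<forall>r < length (transpose Q).
     list_all2 (\<le>) (key_col P r) (map (part lam) (rev (key_col Q r))))"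
proof -
  let ?m = "length (transpose Q)"
  have "transpose (transpose (map (key_col P) [0..<?m])) = map (key_col P) [0..<?m]"
    by (rule transpose_transpose_columns[OF _ columns_P[symmetric]]) (rule length_key_col[OF P])
  moreover have "right_key P = transpose (map (key_col P) [0..<?m])"
    by (simp add: right_key_eq columns_P)
  ultimately show ?thesis
    using filling_le_transpose_iff B_plus_columns B_plus_eq
    by (simp add: list_all2_conv_all_nth)
qed

text \<open>Combines \<open>column_le_iff\<close> with the counts of \<open>filter_key_col\<close>;
  past the last column the inequality reads \<open>0 \<le> 0\<close>, so \<open>r\<close> is
  unrestricted.\<close>

lemma right_key_le_iff:
  "filling_le (right_key P) (B_plus lam \<alpha>) \<longleftrightarrow> (\<forall>a \<in> {1..length lam}. \<forall>r.
     decr_len (part lam a) P r + decr_len (a - 1) Q r \<le> col_len Q r)"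
proof -
  have "list_all2 (\<le>) (key_col P r) (map (part lam) (rev (key_col Q r))) \<longleftrightarrow>
      (\<forall>a \<in> {1..length lam}. length (filter (\<lambda>x. part lam a < x) (key_col P r)) +
         length (filter (\<lambda>y. a - 1 < y) (key_col Q r)) \<le> col_len Q r)" for r
  proof (rule column_le_iff)
    show "set (key_col Q r) \<subseteq> {1..length lam}" using set_key_col[OF Q(1) Q_pos] Q(2) by blast
  qed (simp_all add: part_antimono sorted_key_col P Q(1) Q_pos length_key_col col_len_P)
  moreover have "decr_len b P r + decr_len a Q r \<le> col_len Q r" if "\<not> r < length (transpose Q)" for a b r
  proof -
    have "col_len Q r = 0" using that col_len_pos_iff[of Q r] by simp
    then show ?thesis
      using decr_len_le_col_len[OF P(1), of b r] decr_len_le_col_len[OF Q(1), of a r] col_len_P[of r]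
      by simp
  qed
  ultimately show ?thesis
    unfolding right_key_le_iff_columns filter_key_col[OF P] filter_key_col[OF Q(1) Q_pos] by blast
qed

text \<open>The right key of \<open>P\<close> has positive entries, and by
  \<open>strictify_ge\<close> they bound the strictified columns from below.\<close>

lemma comp_pow_exists:
  assumes "filling_le (right_key P) (B_plus lam \<alpha>)"
  shows "comp_pow lam \<alpha> \<noteq> None"
proof -
  have "x > 0" if row: "row \<in> set (str_B_plus lam \<alpha>)" "x \<in> set row" for row x
  proof -
    obtain r where r: "r < length (transpose Q)" and
      x: "x \<in> set (strictify (rev (map int (map (part lam) (rev (key_col Q r))))))"
      using transpose_entries[OF row(1)[unfolded str_B_plus_def B_plus_columns] row(2)] by auto
    let ?ks = "rev (map int (key_col P r))"
    have "list_all2 (\<le>) (key_col P r) (map (part lam) (rev (key_col Q r)))"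
      using assms r right_key_le_iff_columns by blast
    then have "list_all2 (\<le>) ?ks (rev (map int (map (part lam) (rev (key_col Q r)))))"
      by (simp add: list_all2_map1 list_all2_map2 del: map_map)
    moreover have "sorted_wrt (>) ?ks"
      using sorted_key_col[OF P] by (simp add: sorted_wrt_rev sorted_wrt_map)
    ultimately have "list_all2 (\<le>) ?ks (strictify (rev (map int (map (part lam) (rev (key_col Q r))))))"
      by (rule strictify_ge)
    then obtain k where k: "k \<in> set ?ks" "k \<le> x"
      using x by (metis in_set_conv_nth list_all2_conv_all_nth)
    have "y \<noteq> 0" if "y \<in> set (key_col P r)" for y
      using that set_key_col[OF P] P(2) by (metis subsetD)
    then have "0 < k" using k(1) by fastforce
    then show ?thesis using k(2) by simp
  qed
  then show ?thesis unfolding comp_pow_def by simp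
qed

end

theorem theorem25:
  fixes lam :: "nat list"
  assumes "sorted_wrt (\<ge>) lam"
  shows "bij_betw RSK (admissible_biwords lam) (G lam)"
proof (rule bij_betw_imageI)
  show "inj_on RSK (admissible_biwords lam)"
    unfolding inj_on_def admissible_biwords_def by (auto intro: RSK_inj)
  have Tab: "T \<in> Tab r \<nu> \<longleftrightarrow> ssyt T \<and> entries T \<subseteq> {1..r} \<and>
      map length T = filter (\<lambda>k. k \<noteq> 0) \<nu>" for T r \<nu>
    by (auto simp: Tab_def entries_def)
  show "RSK ` admissible_biwords lam = G lam"
  proof (intro set_eqI iffI)
    fix PQ assume "PQ \<in> RSK ` admissible_biwords lam"
    then obtain w where w': "w \<in> admissible_biwords lam" "PQ = RSK w" by blast
    obtain P Q where PQ: "RSK w = (P, Q)" by (cases "RSK w")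
    with w' have w: "lex_ordered w" "\<forall>b \<in> set w. admissible lam b" "RSK w = (P, Q)" "PQ = (P, Q)"
      by (auto simp: admissible_biwords_def)
    note content = RSK_content[OF w(1,3), folded entries_def]
    have P: "ssyt P" "entries P \<subseteq> {1..part lam 1}" and Q: "ssyt Q" "entries Q \<subseteq> {1..length lam}"
      using RSK_ssyt[OF w(1,3)] w(2) unfolding content by (auto simp: admissible_def)
    have shape: "map length P = map length Q" by (rule RSK_shape[OF w(1,3)])
    obtain \<alpha> where \<alpha>: "length \<alpha> = length lam" "right_key Q = key \<alpha>"
        "map length Q = filter (\<lambda>k. k \<noteq> 0) (decr_rearr \<alpha>)"
      using right_key_is_key[OF Q] .
    have P0: "0 \<notin> entries P" using P(2) by auto
    note ctx = assms P(1) P0 Q shape \<alpha>(2)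
    have le: "filling_le (right_key P) (B_plus lam \<alpha>)"
      unfolding right_key_le_iff[OF ctx]
    proof
      fix a assume a: "a \<in> {1..length lam}"
      \<comment> \<open>If \<open>i \<ge> a\<close>, then
        \<open>j \<le> part lam i \<le> part lam a\<close>.\<close>
      have "i \<le> a - 1 \<or> j \<le> part lam a" if "(i, j) \<in> set w" for i j
      proof (cases "a \<le> i")
        case True
        have "i \<le> length lam" "j \<le> part lam i" using w(2) that by (auto simp: admissible_def)
        then show ?thesis using part_antimono[OF ctx, of a i] True a by simp
      qed (use a in auto)
      then show "\<forall>r. decr_len (part lam a) P r + decr_len (a - 1) Q r \<le> col_len Q r"
        unfolding RSK_corner_empty[OF w(1,3)] by auto
    qed
    have "\<alpha> \<in> Comp lam" using comp_pow_exists[OF ctx le] \<alpha>(1) by (simp add: Comp_def)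
    moreover have "P \<in> S_left lam \<alpha>" "Q \<in> S_right \<alpha>"
      using P Q \<alpha> le shape by (simp_all add: S_left_def S_right_def Tab)
    ultimately show "PQ \<in> G lam" using w(4) by (auto simp: G_def)
  next
    fix PQ assume "PQ \<in> G lam"
    then obtain \<alpha> P Q where PQ: "PQ = (P, Q)" "\<alpha> \<in> Comp lam" "P \<in> S_left lam \<alpha>" "Q \<in> S_right \<alpha>"
      by (auto simp: G_def)
    have \<alpha>: "length \<alpha> = length lam" using PQ(2) by (simp add: Comp_def)
    have P: "ssyt P" "entries P \<subseteq> {1..part lam 1}" and Q: "ssyt Q" "entries Q \<subseteq> {1..length lam}"
      and shape: "map length P = map length Q" and key: "right_key Q = key \<alpha>"
      and le: "filling_le (right_key P) (B_plus lam \<alpha>)"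
      using PQ(3,4) \<alpha> by (auto simp: S_left_def S_right_def Tab)
    have P0: "0 \<notin> entries P" using P(2) by auto
    note ctx = assms P(1) P0 Q shape key
    obtain w where w: "lex_ordered w" "RSK w = (P, Q)" using RSK_surj[OF Q(1) P(1) shape] by blast
    note content = RSK_content[OF w, folded entries_def]
    have "admissible lam (i, j)" if ij: "(i, j) \<in> set w" for i j
    proof -
      have i: "i \<in> {1..length lam}" and j: "j \<in> {1..part lam 1}"
        using ij P(2) Q(2) unfolding content by force+
      \<comment> \<open>The thresholds are chosen for the biletter itself; since
        \<open>i \<ge> 1\<close>, the alternative \<open>i \<le> i - 1\<close> is
        impossible.\<close>
      have "\<forall>r. decr_len (part lam i) P r + decr_len (i - 1) Q r \<le> col_len Q r"
        using le i unfolding right_key_le_iff[OF ctx] by blast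
      then have "i \<le> i - 1 \<or> j \<le> part lam i"
        unfolding RSK_corner_empty[OF w] using ij by blast
      then show ?thesis using i j by (auto simp: admissible_def)
    qed
    then have "w \<in> admissible_biwords lam" using w(1) by (auto simp: admissible_biwords_def)
    then show "PQ \<in> RSK ` admissible_biwords lam" using w(2) PQ(1) by (metis imageI)
  qed
qed

end
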